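(* Let $1\le p\le2$ and $0<R_1\le R_2<\infty$. There exists a constant $C=C(p,R_1,R_2)>0$, depending only on $p,R_1,R_2$, such that the following holds. Let $(\Omega,\mu)$ be a probability space, let $N\ge2$ be an integer, and let $\Phi_N=\{\varphi_j\}_{j=1}^N$ be a uniformly bounded Riesz basis of $X_N:=\operatorname{span}(\Phi_N)\subset L_2(\Omega)$ with Riesz constants $R_1,R_2$. Let $1\le v\le N$ be an integer. Then for any $\varepsilon\in(0,1)$ there exist $m$ points $\xi^1,\dots,\xi^m\in\Omega$ with $$m\le C\,\varepsilon^{-p-5}\,v(\log N)^2(\log(2v\varepsilon^{-1}))^2$$ such that for every $f\in\Sigma_v(\Phi_N)$, $$(1-\varepsilon)\|f\|_p^p\le\frac1m\sum_{j=1}^m|f(\xi^j)|^p\le(1+\varepsilon)\|f\|_p^p .$$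
   Context: $(\Omega,\mu)$ is a probability space, $L_p=L_p(\Omega,\mu)$ is the real Lebesgue space with norm $\|\cdot\|_p$, $1\le p\le\infty$. Functions are real-valued and defined everywhere on $\Omega$, and every $f\in X_N$ with zero norm is $0\in X_N$. "$\Phi_N=\{\varphi_j\}_{j=1}^N$ is a uniformly bounded Riesz basis of $X_N=\operatorname{span}(\varphi_1,\dots,\varphi_N)$ with constants $R_1,R_2$" means: $\|\varphi_j\|_\infty\le 1$ for $1\le j\le N$, and for all $(a_1,\dots,a_N)\in\mathbb R^N$ $$R_1\Big(\sum_{j=1}^N|a_j|^2\Big)^{1/2}\le\Big\|\sum_{j=1}^N a_j\varphi_j\Big\|_2\le R_2\Big(\sum_{j=1}^N|a_j|^2\Big)^{1/2}.$$ $\Sigma_v(\Phi_N)$ is the set of all $f=\sum_{i\in G}c_i\varphi_i$ with $G\subset\{1,\dots,N\}$, $|G|=v$, and arbitrary real $c_i$. The points $\xi^j$ need not be distinct. *)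

theory Defs
  imports "HOL-Probability.Probability"
begin

text \<open>
  For \<open>p < \<infinity>\<close>; meaningful on \<open>L_p\<close>, since the Bochner integral of a non-integrable
  function is 0. It is only applied below to essentially bounded measurable functions on
  probability spaces.
\<close>
definition Lp_norm :: "'a measure \<Rightarrow> real \<Rightarrow> ('a \<Rightarrow> real) \<Rightarrow> real" where
  "Lp_norm M p f = (\<integral>x. \<bar>f x\<bar> powr p \<partial>M) powr (1 / p)"

definition Linf_norm :: "'a measure \<Rightarrow> ('a \<Rightarrow> real) \<Rightarrow> ereal" where
  "Linf_norm M f = esssup M (\<lambda>x. ereal \<bar>f x\<bar>)"

text \<open>
  On a probability space, measurability and \<open>Linf_norm M (\<phi> j) \<le> 1\<close> give
  \<open>\<phi> j \<in> L_2\<close>. For \<open>R1 > 0\<close> the lower Riesz bound gives linear independence, and also that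
  an element of the span of zero norm has all coefficients zero and hence vanishes everywhere,
  so neither of these is a separate assumption.
\<close>
definition bounded_Riesz_basis ::
    "'a measure \<Rightarrow> nat \<Rightarrow> (nat \<Rightarrow> 'a \<Rightarrow> real) \<Rightarrow> real \<Rightarrow> real \<Rightarrow> bool" where
  "bounded_Riesz_basis M N \<phi> R1 R2 \<longleftrightarrow>
     (\<forall>j\<in>{1..N}. \<phi> j \<in> borel_measurable M \<and> Linf_norm M (\<phi> j) \<le> 1) \<and>
     (\<forall>a :: nat \<Rightarrow> real.
        R1 * sqrt (\<Sum>j=1..N. \<bar>a j\<bar>\<^sup>2) \<le> Lp_norm M 2 (\<lambda>x. \<Sum>j=1..N. a j * \<phi> j x) \<and>
        Lp_norm M 2 (\<lambda>x. \<Sum>j=1..N. a j * \<phi> j x) \<le> R2 * sqrt (\<Sum>j=1..N. \<bar>a j\<bar>\<^sup>2))"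

definition sparse_sums :: "nat \<Rightarrow> nat \<Rightarrow> (nat \<Rightarrow> 'a \<Rightarrow> real) \<Rightarrow> ('a \<Rightarrow> real) set" where
  "sparse_sums v N \<phi> =
     {f. \<exists>G c. G \<subseteq> {1..N} \<and> card G = v \<and> f = (\<lambda>x. \<Sum>i\<in>G. c i * \<phi> i x)}"

text \<open>
  \<open>C\<close> works on the measure space \<open>M\<close> for all systems and all values of \<open>N\<close>, \<open>v\<close>, \<open>\<epsilon>\<close>.
\<close>
definition sampling_bound ::
    "'a measure \<Rightarrow> real \<Rightarrow> real \<Rightarrow> real \<Rightarrow> real \<Rightarrow> bool" where
  "sampling_bound M p R1 R2 C \<longleftrightarrow>
     (\<forall>N \<phi> v \<epsilon>. 2 \<le> N \<longrightarrow> bounded_Riesz_basis M N \<phi> R1 R2 \<longrightarrow>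
        1 \<le> v \<longrightarrow> v \<le> N \<longrightarrow> 0 < \<epsilon> \<longrightarrow> \<epsilon> < 1 \<longrightarrow>
        (\<exists>(m::nat) (\<xi> :: nat \<Rightarrow> 'a). 1 \<le> m \<and> (\<forall>j\<in>{1..m}. \<xi> j \<in> space M) \<and>
           real m \<le> C * \<epsilon> powr (- p - 5) * real v * (ln (real N))\<^sup>2 * (ln (2 * real v / \<epsilon>))\<^sup>2 \<and>
           (\<forall>f\<in>sparse_sums v N \<phi>.
              (1 - \<epsilon>) * Lp_norm M p f powr p \<le> (\<Sum>j=1..m. \<bar>f (\<xi> j)\<bar> powr p) / real m \<and>
              (\<Sum>j=1..m. \<bar>f (\<xi> j)\<bar> powr p) / real m \<le> (1 + \<epsilon>) * Lp_norm M p f powr p)))"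

text \<open>
  The constant must not depend on the probability space, in particular not on the type of its
  points. HOL cannot quantify over types under an existential quantifier, so
  \<open>\<exists>C > 0. \<forall>M :: 'a measure. ...\<close> would allow a different \<open>C\<close> for each type \<open>'a\<close>. Hence
  \<open>C(p, R1, R2)\<close> is a constant of type \<^typ>\<open>real\<close> that does not mention \<open>'a\<close>. It is chosen to
  work for all probability spaces over \<^typ>\<open>nat \<Rightarrow> real\<close>, and these are sufficiently general: a
  system \<open>\<phi> 1, ..., \<phi> N\<close> on any space factors through the range of
  \<open>x \<mapsto> (\<phi> 1 x, ..., \<phi> N x)\<close> with the image sigma-algebra and image measure. If no positive
  constant worked there, nothing would be known about the chosen value.
\<close>
definition sampling_const :: "real \<Rightarrow> real \<Rightarrow> real \<Rightarrow> real" where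
  "sampling_const p R1 R2 =
     (SOME C. 0 < C \<and>
        (\<forall>M :: (nat \<Rightarrow> real) measure. prob_space M \<longrightarrow> sampling_bound M p R1 R2 C))"

end

(*
  The idea. Let |f|^p have mean 1 on a finite probability space with uniform measure. Write |f|^p,
  up to a small error, as the sum of O(log(v/eps)) dyadic slices of its values. The slice of height s
  is a function with values in [0, O(s^p)] and mean at most 1, so by Bernstein's inequality
  independent samples reproduce its mean up to delta except with probability 2 exp(-c m delta^2 / s^p).
  To that accuracy the slice depends only on f up to eps*s in the sup norm, and the unit L_p ball of
  the v-sparse functions has sup norm entropy at most K / u^p at scale u, with K of order
  v log N log(size of the space). Hence the union bound over the nets costs the same power s^(-p) as
  Bernstein's inequality gains, for every s at once.

  The entropy bound comes from passing from scale 2u to u: two functions at sup distance 2u differ by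
  a 2v-sparse function, whose L_2 norm, hence by the Riesz bound its coefficient sum, is controlled by
  interpolation between L_p and the sup norm, and Maurey's empirical method approximates it.

  A general space is first replaced by polynomially many (in N/eps) sample points. This is the same
  sampling argument with the trivial nets obtained from rounding coefficients, applied to p and to 2
  simultaneously so that the Riesz bound survives.
*)
theory Submission
  imports Defs
begin

section \<open>Bernstein's inequality for independent samples\<close>

text \<open>Where the exponents come from. The \<open>n\<close> slices, with \<open>n\<close> of
  order \<open>ln (2 * v / \<epsilon>)\<close>, are each sampled to accuracy of order
  \<open>\<epsilon> / n\<close>, which costs \<open>n\<^sup>2 / \<epsilon>\<^sup>2\<close>. Nets of
  relative precision of order \<open>\<epsilon>\<close> cost \<open>\<epsilon> powr (- p)\<close>,
  bounded by a multiple of \<open>1 / \<epsilon>\<^sup>2\<close>. The entropy constant contains the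
  logarithm of the number of intermediate points, at most a multiple of
  \<open>ln N / \<epsilon>\<close>, and this spends one more power of \<open>1 / \<epsilon>\<close>.
  So the sample size comes out with \<open>1 / \<epsilon> ^ 5\<close>, which is below
  \<open>\<epsilon> powr (- p - 5)\<close>. The obstacle that forces two stages is Maurey's method:
  it controls the error at finitely many points only, by a union bound that costs the logarithm of
  their number. Since only this logarithm enters, the first stage may waste any fixed power of
  \<open>N / \<epsilon>\<close>. Sampling results give events of high probability and not just one
  sample, so that a single sample can serve the exponents \<open>p\<close> and 2 together.\<close>

lemma exp_le_quadratic:
  fixes x :: real
  assumes "x \<le> 1"
  shows "exp x \<le> 1 + x + x\<^sup>2"
proof (cases "0 \<le> x")
  case True
  then show ?thesis using exp_bound[of x] assms by simp
next
  case False
  define y where "y = - x"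
  have y: "0 < y" using False by (simp add: y_def)
  have 1: "1 + y + y\<^sup>2 / 2 \<le> exp y" using exp_lower_Taylor_quadratic[of y] y by simp
  have 2: "0 \<le> 1 - y + y\<^sup>2"
    using zero_le_power2[of "y - 1/2"] by (simp add: power2_eq_square algebra_simps)
  \<comment> \<open>The Taylor lower bound for \<open>exp y\<close> times the claimed upper bound
    for \<open>exp (- y)\<close> is at least 1, so the latter dominates
    \<open>1 / exp y\<close>.\<close>
  have "(1 + y + y\<^sup>2 / 2) * (1 - y + y\<^sup>2) = 1 + (y^2 + y^3 + y^4) / 2"
    by (simp add: field_simps power2_eq_square power3_eq_cube power4_eq_xxxx)
  then have "1 \<le> (1 + y + y\<^sup>2 / 2) * (1 - y + y\<^sup>2)" using y by simp
  also have "\<dots> \<le> exp y * (1 - y + y\<^sup>2)" using 1 2 by (rule mult_right_mono)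
  finally have "1 / exp y \<le> 1 - y + y\<^sup>2" by (simp add: field_simps)
  then show ?thesis by (simp add: y_def exp_minus inverse_eq_divide)
qed

text \<open>Chernoff's method. One number \<open>A\<close> bounds both the sup norm and the
  variance, which gives an exponent of order \<open>1 / A\<close>, where Hoeffding's inequality
  would give \<open>1 / A\<^sup>2\<close>.\<close>

lemma bernstein_upper_tail:
  fixes X :: "'a \<Rightarrow> real"
  assumes "prob_space M" and X[measurable]: "X \<in> borel_measurable M"
    and bd: "\<And>x. x \<in> space M \<Longrightarrow> \<bar>X x\<bar> \<le> A" and A: "0 < A"
    and mean: "(\<integral>x. X x \<partial>M) = 0" and var: "(\<integral>x. (X x)\<^sup>2 \<partial>M) \<le> A"
    and d: "0 < d" "d \<le> 2"
  shows "measure (Pi\<^sub>M {..<m} (\<lambda>_. M)) {\<xi> \<in> space (Pi\<^sub>M {..<m} (\<lambda>_. M)). real m * d \<le> (\<Sum>i<m. X (\<xi> i))}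
    \<le> exp (- (real m * d\<^sup>2 / (4 * A)))"
proof -
  interpret prob_space M by fact
  interpret P: product_prob_space "\<lambda>_. M" "{..<m}" ..
  let ?P = "Pi\<^sub>M {..<m} (\<lambda>_. M)"
  \<comment> \<open>This \<open>l\<close> minimizes \<open>l\<^sup>2 * A - l * d\<close>, and
    \<open>d \<le> 2\<close> keeps \<open>l * X x\<close> in the range of
    \<open>exp_le_quadratic\<close>.\<close>
  define l where "l = d / (2 * A)"
  have l: "0 < l" using d A by (simp add: l_def)
  have lA: "l * A \<le> 1" using d A by (simp add: l_def)
  have lX: "\<bar>l * X x\<bar> \<le> 1" if "x \<in> space M" for x
  proof -
    have "\<bar>l * X x\<bar> \<le> l * A" using l bd[OF that] by (simp add: abs_mult)
    then show ?thesis using lA by simp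
  qed
  have intX: "integrable M X"
    by (rule integrable_const_bound[where B=A]) (use bd in auto)
  have intX2: "integrable M (\<lambda>x. (X x)\<^sup>2)"
  proof (rule integrable_const_bound[where B="A\<^sup>2"])
    show "AE x in M. norm ((X x)\<^sup>2) \<le> A\<^sup>2"
      using bd power_mono[of "\<bar>X _\<bar>" A 2] by (intro AE_I2) (simp)
  qed simp
  have intE: "integrable M (\<lambda>x. exp (l * X x))"
  proof (rule integrable_const_bound[where B="exp 1"])
    show "AE x in M. norm (exp (l * X x)) \<le> exp 1"
      using lX by (intro AE_I2) (auto simp: abs_le_iff)
  qed simp
  have mgf: "(\<integral>x. exp (l * X x) \<partial>M) \<le> exp (l\<^sup>2 * A)"
  proof -
    have "(\<integral>x. exp (l * X x) \<partial>M) \<le> (\<integral>x. 1 + l * X x + l\<^sup>2 * (X x)\<^sup>2 \<partial>M)"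
      using exp_le_quadratic lX
      by (intro integral_mono intE Bochner_Integration.integrable_add integrable_mult_right intX intX2)
         (auto simp: power_mult_distrib[symmetric] abs_le_iff)
    also have "\<dots> = 1 + l\<^sup>2 * (\<integral>x. (X x)\<^sup>2 \<partial>M)"
      using intX intX2 mean by (simp add: prob_space)
    also have "\<dots> \<le> 1 + l\<^sup>2 * A" using var by (simp add: mult_left_mono)
    also have "\<dots> \<le> exp (l\<^sup>2 * A)" by (rule exp_ge_add_one_self)
    finally show ?thesis .
  qed
  have Pint: "integrable ?P (\<lambda>\<xi>. \<Prod>i<m. exp (l * X (\<xi> i)))"
    by (rule P.product_integrable_prod) (use intE in auto)
  have "measure ?P {\<xi> \<in> space ?P. real m * d \<le> (\<Sum>i<m. X (\<xi> i))}
     = measure ?P {\<xi> \<in> space ?P. exp (l * (real m * d)) \<le> (\<Prod>i<m. exp (l * X (\<xi> i)))}"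
    using l by (simp add: exp_sum[symmetric] sum_distrib_left[symmetric])
  also have "\<dots> \<le> (\<integral>\<xi>. (\<Prod>i<m. exp (l * X (\<xi> i))) \<partial>?P) / exp (l * (real m * d))"
    by (rule integral_Markov_inequality_measure[where A="space ?P"])
       (use Pint in \<open>auto intro!: AE_I2 prod_nonneg\<close>)
  also have "(\<integral>\<xi>. (\<Prod>i<m. exp (l * X (\<xi> i))) \<partial>?P) = (\<integral>x. exp (l * X x) \<partial>M) ^ m"
    by (subst P.product_integral_prod) (use intE in auto)
  also have "\<dots> \<le> exp (l\<^sup>2 * A) ^ m"
    by (rule power_mono[OF mgf]) simp
  also have "\<dots> / exp (l * (real m * d)) = exp (real m * (l\<^sup>2 * A) - l * (real m * d))"
    by (simp add: exp_diff exp_of_nat_mult)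
  also have "real m * (l\<^sup>2 * A) - l * (real m * d) = - (real m * d\<^sup>2 / (4 * A))"
    using A by (simp add: l_def field_simps power2_eq_square)
  finally show ?thesis by (simp add: divide_right_mono)
qed

text \<open>For values in \<open>[0, A]\<close> and mean at most 1 the second moment is at most
  \<open>A\<close> times the mean, so the variance is linear in \<open>A\<close>; the upper tail
  bound then applies to both signs of the centred function.\<close>

lemma bernstein_tail:
  fixes a :: "'a \<Rightarrow> real"
  assumes "prob_space M" and a[measurable]: "a \<in> borel_measurable M"
    and bd: "\<And>x. x \<in> space M \<Longrightarrow> 0 \<le> a x \<and> a x \<le> A" and A: "0 < A"
    and mean: "(\<integral>x. a x \<partial>M) \<le> 1"
    and d: "0 < d" "d \<le> 2" and m: "0 < m"
  defines "P \<equiv> Pi\<^sub>M {..<m} (\<lambda>_. M)"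
  shows "{\<xi> \<in> space P. d < \<bar>(\<Sum>i<m. a (\<xi> i)) / m - (\<integral>x. a x \<partial>M)\<bar>} \<in> sets P"
    and "measure P {\<xi> \<in> space P. d < \<bar>(\<Sum>i<m. a (\<xi> i)) / m - (\<integral>x. a x \<partial>M)\<bar>}
      \<le> 2 * exp (- (real m * d\<^sup>2 / (4 * A)))"
proof -
  interpret prob_space M by fact
  interpret P: product_prob_space "\<lambda>_. M" "{..<m}" ..
  interpret PP: prob_space P unfolding P_def by (rule P.prob_space_axioms)
  define e where "e = (\<integral>x. a x \<partial>M)"
  have int: "integrable M a"
    by (rule integrable_const_bound[where B=A]) (use bd in auto)
  have int2: "integrable M (\<lambda>x. (a x)\<^sup>2)"
  proof (rule integrable_const_bound[where B="A\<^sup>2"])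
    show "AE x in M. norm ((a x)\<^sup>2) \<le> A\<^sup>2"
      using bd by (intro AE_I2) (simp add: power_mono)
  qed simp
  have e0: "0 \<le> e" unfolding e_def using bd by (intro integral_nonneg_AE AE_I2) auto
  have "e \<le> (\<integral>x. A \<partial>M)" unfolding e_def using bd by (intro integral_mono int) auto
  then have eA: "e \<le> A" by (simp add: prob_space)
  have "(\<integral>x. (a x - e)\<^sup>2 \<partial>M) = (\<integral>x. (a x)\<^sup>2 - 2 * e * a x + e\<^sup>2 \<partial>M)"
    by (simp add: power2_diff algebra_simps)
  also have "\<dots> = (\<integral>x. (a x)\<^sup>2 \<partial>M) - 2 * e * e + e\<^sup>2"
    using int int2 by (simp add: prob_space e_def)
  also have "\<dots> \<le> (\<integral>x. (a x)\<^sup>2 \<partial>M)" by (simp add: power2_eq_square)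
  also have "\<dots> \<le> (\<integral>x. A * a x \<partial>M)"
    using bd by (intro integral_mono int2 integrable_mult_right int)
       (auto simp: power2_eq_square intro!: mult_right_mono)
  also have "\<dots> \<le> A" using mean A by simp
  finally have var: "(\<integral>x. (a x - e)\<^sup>2 \<partial>M) \<le> A" .
  define U where "U = {\<xi> \<in> space P. real m * d \<le> (\<Sum>i<m. (a (\<xi> i) - e))}"
  define L where "L = {\<xi> \<in> space P. real m * d \<le> (\<Sum>i<m. (e - a (\<xi> i)))}"
  have ae: "\<bar>a x - e\<bar> \<le> A" "\<bar>e - a x\<bar> \<le> A" if "x \<in> space M" for x
    using bd[OF that] e0 eA by auto
  have U: "measure P U \<le> exp (- (real m * d\<^sup>2 / (4 * A)))"
    unfolding U_def P_def
    by (rule bernstein_upper_tail[OF \<open>prob_space M\<close> _ _ A _ var d])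
       (use int ae in \<open>auto simp: prob_space e_def\<close>)
  have L: "measure P L \<le> exp (- (real m * d\<^sup>2 / (4 * A)))"
    unfolding L_def P_def
    by (rule bernstein_upper_tail[OF \<open>prob_space M\<close> _ _ A _ _ d])
       (use int ae var in \<open>auto simp: prob_space e_def power2_commute\<close>)
  have [measurable]: "U \<in> sets P" "L \<in> sets P" unfolding U_def L_def P_def by measurable
  show "{\<xi> \<in> space P. d < \<bar>(\<Sum>i<m. a (\<xi> i)) / m - (\<integral>x. a x \<partial>M)\<bar>} \<in> sets P"
    unfolding P_def by measurable
  have "{\<xi> \<in> space P. d < \<bar>(\<Sum>i<m. a (\<xi> i)) / m - (\<integral>x. a x \<partial>M)\<bar>} \<subseteq> U \<union> L"
    using m by (auto simp: U_def L_def e_def[symmetric] sum_subtractf field_simps abs_if split: if_splits)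
  then have "measure P {\<xi> \<in> space P. d < \<bar>(\<Sum>i<m. a (\<xi> i)) / m - (\<integral>x. a x \<partial>M)\<bar>} \<le> measure P (U \<union> L)"
    by (intro PP.finite_measure_mono) auto
  also have "\<dots> \<le> measure P U + measure P L" by (rule measure_Un_le) auto
  finally show "measure P {\<xi> \<in> space P. d < \<bar>(\<Sum>i<m. a (\<xi> i)) / m - (\<integral>x. a x \<partial>M)\<bar>}
      \<le> 2 * exp (- (real m * d\<^sup>2 / (4 * A)))" using U L by simp
qed

text \<open>A union bound in which every function keeps its own height \<open>A i\<close>, so that
  slices of very different heights can share one sample.\<close>

lemma simultaneous_sampling:
  fixes a :: "'i \<Rightarrow> 'a \<Rightarrow> real"
  assumes M: "prob_space M" and I: "finite I"
    and a: "\<And>i. i \<in> I \<Longrightarrow> a i \<in> borel_measurable M"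
    and bd: "\<And>i x. i \<in> I \<Longrightarrow> x \<in> space M \<Longrightarrow> 0 \<le> a i x \<and> a i x \<le> A i"
    and A: "\<And>i. i \<in> I \<Longrightarrow> 0 < A i"
    and mean: "\<And>i. i \<in> I \<Longrightarrow> (\<integral>x. a i x \<partial>M) \<le> 1"
    and d: "0 < d" "d \<le> 2" and m: "0 < m"
    and small: "(\<Sum>i\<in>I. 2 * exp (- (real m * d\<^sup>2 / (4 * A i)))) \<le> q"
  defines "P \<equiv> Pi\<^sub>M {..<m} (\<lambda>_. M)"
  obtains E where "E \<in> sets P" "measure P E \<ge> 1 - q"
    "\<And>\<xi> i. \<xi> \<in> E \<Longrightarrow> i \<in> I \<Longrightarrow> \<bar>(\<Sum>j<m. a i (\<xi> j)) / m - (\<integral>x. a i x \<partial>M)\<bar> \<le> d"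
proof -
  interpret prob_space M by fact
  interpret P: product_prob_space "\<lambda>_. M" "{..<m}" ..
  interpret PP: prob_space P unfolding P_def by (rule P.prob_space_axioms)
  define bad where "bad i = {\<xi> \<in> space P. d < \<bar>(\<Sum>j<m. a i (\<xi> j)) / m - (\<integral>x. a i x \<partial>M)\<bar>}" for i
  have bad: "bad i \<in> sets P" "measure P (bad i) \<le> 2 * exp (- (real m * d\<^sup>2 / (4 * A i)))" if "i \<in> I" for i
    using bernstein_tail[OF M a[OF that] bd[OF that] A[OF that] mean[OF that] d m]
    by (auto simp: bad_def P_def)
  have [measurable]: "(\<Union>i\<in>I. bad i) \<in> sets P" using I bad by auto
  have "measure P (\<Union>i\<in>I. bad i) \<le> (\<Sum>i\<in>I. measure P (bad i))"
    by (rule measure_UNION_le) (use I bad in auto)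
  also have "\<dots> \<le> q" by (rule order_trans[OF sum_mono[OF bad(2)] small])
  finally have "1 - q \<le> measure P (space P - (\<Union>i\<in>I. bad i))"
    by (subst PP.prob_compl) auto
  moreover have "space P - (\<Union>i\<in>I. bad i) \<in> sets P" by measurable
  ultimately show thesis
    by (intro that[of "space P - (\<Union>i\<in>I. bad i)"]) (auto simp: bad_def not_less)
qed

section \<open>Dyadic slices of a power\<close>

lemma powr_Lipschitz:
  fixes a b S p :: real
  assumes p: "1 \<le> p" "p \<le> 2" and a: "0 \<le> a" "a \<le> S" and b: "0 \<le> b" "b \<le> S"
  shows "\<bar>a powr p - b powr p\<bar> \<le> 2 * S powr (p - 1) * \<bar>a - b\<bar>"
proof -
  have main: "v powr p - u powr p \<le> 2 * S powr (p - 1) * (v - u)"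
    if uv: "0 \<le> u" "u < v" "v \<le> S" for u v
  proof -
    have "continuous_on {u..v} (\<lambda>x. x powr p)"
      using uv p by (intro continuous_on_powr' continuous_intros) auto
    moreover have "((\<lambda>x. x powr p) has_real_derivative p * x powr (p - 1)) (at x)" if "u < x" for x
      using that uv by (intro has_real_derivative_powr) auto
    ultimately obtain l z where z: "u < z" "z < v"
        "((\<lambda>x. x powr p) has_real_derivative l) (at z)" "v powr p - u powr p = (v - u) * l"
      using MVT[OF uv(2), of "\<lambda>x. x powr p"] by (metis real_differentiable_def)
    have "l = p * z powr (p - 1)"
      using z uv by (intro DERIV_unique[OF z(3)] has_real_derivative_powr) auto
    also have "\<dots> \<le> 2 * S powr (p - 1)"
      using z uv p by (intro mult_mono powr_mono2) auto
    finally have "(v - u) * l \<le> (v - u) * (2 * S powr (p - 1))"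
      using uv by (intro mult_left_mono) auto
    then show ?thesis using z by (simp add: mult.commute)
  qed
  have mono: "u powr p \<le> v powr p" if "0 \<le> u" "u \<le> v" for u v
    using that p by (intro powr_mono2) auto
  show ?thesis
    using main[of a b] main[of b a] mono[of a b] mono[of b a] a b
    by (cases a b rule: linorder_cases) (auto simp: abs_if)
qed

text \<open>A difference of truncations rather than \<open>\<bar>y\<bar> powr p\<close> cut off to a
  dyadic range of values: it is continuous in \<open>y\<close>, hence stable under small sup norm
  errors, and it telescopes along \<open>s\<close>, \<open>2 * s\<close>,
  \<open>4 * s\<close>.\<close>

definition level :: "real \<Rightarrow> real \<Rightarrow> real \<Rightarrow> real" where
  "level p s y = min \<bar>y\<bar> (2 * s) powr p - min \<bar>y\<bar> s powr p"

lemma level_nonneg: "1 \<le> p \<Longrightarrow> 0 \<le> s \<Longrightarrow> 0 \<le> level p s y"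
  unfolding level_def by (simp add: powr_mono2)

lemma level_le_abs_powr: "1 \<le> p \<Longrightarrow> 0 \<le> s \<Longrightarrow> level p s y \<le> \<bar>y\<bar> powr p"
proof -
  assume p: "1 \<le> p" "0 \<le> s"
  have "min \<bar>y\<bar> (2 * s) powr p \<le> \<bar>y\<bar> powr p" using p by (intro powr_mono2) auto
  then show ?thesis unfolding level_def using powr_ge_zero[of "min \<bar>y\<bar> s" p] by linarith
qed

lemma two_powr_le_four: "p \<le> 2 \<Longrightarrow> 2 powr p \<le> (4 :: real)"
  using powr_mono[of p 2 "2::real"] by simp

lemma level_le:
  assumes "1 \<le> p" "p \<le> 2" "0 \<le> s"
  shows "level p s y \<le> 4 * s powr p"
proof -
  have "level p s y \<le> min \<bar>y\<bar> (2 * s) powr p"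
    unfolding level_def using powr_ge_zero[of "min \<bar>y\<bar> s" p] by linarith
  also have "\<dots> \<le> (2 * s) powr p" using assms by (intro powr_mono2) auto
  also have "\<dots> = 2 powr p * s powr p" using assms by (simp add: powr_mult)
  also have "\<dots> \<le> 4 * s powr p" using two_powr_le_four[of p] assms by (intro mult_right_mono) auto
  finally show ?thesis .
qed

lemma level_eq_0: "0 \<le> s \<Longrightarrow> \<bar>y\<bar> \<le> s \<Longrightarrow> level p s y = 0"
  by (simp add: level_def min_def)

lemma level_measurable [measurable]: "level p s \<in> borel_measurable borel"
  unfolding level_def by measurable

lemma sum_level:
  "(\<Sum>k<n. level p (2 ^ k * s) y) = min \<bar>y\<bar> (2 ^ n * s) powr p - min \<bar>y\<bar> s powr p"
  by (induction n) (simp_all add: level_def mult.assoc)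

text \<open>The case distinction is what keeps the total error free of a factor \<open>n\<close>: if
  \<open>\<bar>y\<bar> < s / 2\<close>, then \<open>z\<close> also stays below \<open>s\<close> and
  both slices vanish. The constant 6 bounds the two Lipschitz contributions
  \<open>2 * 2 powr (p - 1) + 2\<close>.\<close>

lemma level_perturb:
  assumes p: "1 \<le> p" "p \<le> 2" and s: "0 < s" and \<eta>: "0 \<le> \<eta>" "\<eta> \<le> 1/2" and yz: "\<bar>y - z\<bar> \<le> \<eta> * s"
  shows "\<bar>level p s y - level p s z\<bar> \<le> (if s \<le> 2 * \<bar>y\<bar> then 6 * \<eta> * s powr p else 0)"
proof (cases "s \<le> 2 * \<bar>y\<bar>")
  case False
  have "\<eta> * s \<le> 1/2 * s" using \<eta> s by (intro mult_right_mono) auto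
  then have "\<bar>z\<bar> \<le> s" using False yz by linarith
  then show ?thesis using False s by (simp add: level_eq_0)
next
  case True
  have lip: "abs (min (abs y) S powr p - min (abs z) S powr p) \<le> 2 * S powr (p - 1) * (\<eta> * s)" if "0 < S" for S
  proof -
    have "abs (min (abs y) S powr p - min (abs z) S powr p) \<le> 2 * S powr (p - 1) * abs (min (abs y) S - min (abs z) S)"
      using that by (intro powr_Lipschitz p) auto
    also have "\<dots> \<le> 2 * S powr (p - 1) * (\<eta> * s)"
    proof (intro mult_left_mono)
      have "abs (min (abs y) S - min (abs z) S) \<le> \<bar>y - z\<bar>" by linarith
      then show "abs (min (abs y) S - min (abs z) S) \<le> \<eta> * s" using yz by linarith
    qed simp
    finally show ?thesis .
  qed
  have "\<bar>level p s y - level p s z\<bar>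
      \<le> 2 * (2 * s) powr (p - 1) * (\<eta> * s) + 2 * s powr (p - 1) * (\<eta> * s)"
  proof -
    have tri: "\<bar>(a - b) - (c - d)\<bar> \<le> \<bar>a - c\<bar> + \<bar>b - d\<bar>" for a b c d :: real by linarith
    have "0 < 2 * s" using s by simp
    then show ?thesis
      unfolding level_def by (intro order_trans[OF tri] add_mono lip s)
  qed
  also have "(2 * s) powr (p - 1) = 2 powr (p - 1) * s powr (p - 1)"
    using s by (simp add: powr_mult)
  also have "2 * (2 powr (p - 1) * s powr (p - 1)) * (\<eta> * s) + 2 * s powr (p - 1) * (\<eta> * s)
      = (2 * 2 powr (p - 1) + 2) * (\<eta> * (s powr (p - 1) * s))" by (simp add: algebra_simps)
  also have "s powr (p - 1) * s = s powr p" using s by (simp add: powr_mult_base mult.commute)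
  also have "(2 * 2 powr (p - 1) + 2) * (\<eta> * s powr p) \<le> 6 * (\<eta> * s powr p)"
    using powr_mono[of "p - 1" 1 "2::real"] p \<eta> by (intro mult_right_mono) auto
  finally show ?thesis using True by simp
qed

lemma sum_geometric_powr:
  assumes p: "1 \<le> p" and s: "0 < (s::real)"
  shows "(\<Sum>k<n. (2 ^ k * s) powr p) \<le> (2 ^ n * s) powr p"
proof (induction n)
  case (Suc n)
  have "2 * (2 ^ n * s) powr p \<le> 2 powr p * (2 ^ n * s) powr p"
    using powr_mono[of 1 p "2::real"] p by (intro mult_right_mono) auto
  also have "\<dots> = (2 ^ Suc n * s) powr p" using s by (simp add: powr_mult mult.assoc)
  finally show ?case using Suc by simp
qed simp

lemma sum_geometric_powr_le:
  assumes p: "1 \<le> p" and s: "0 < (s::real)" and Y: "0 \<le> Y"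
  shows "(\<Sum>k<n. if 2 ^ k * s \<le> Y then (2 ^ k * s) powr p else 0) \<le> 2 * Y powr p"
proof (induction n)
  case (Suc n)
  show ?case
  proof (cases "2 ^ n * s \<le> Y")
    case True
    have "2 ^ k * s \<le> Y" if "k < n" for k
      using True s that power_increasing[of k n "2::real"]
      by (intro order_trans[OF mult_right_mono True]) auto
    then have "(\<Sum>k<Suc n. if 2 ^ k * s \<le> Y then (2 ^ k * s) powr p else 0)
        = (\<Sum>k<n. (2 ^ k * s) powr p) + (2 ^ n * s) powr p" using True by simp
    also have "\<dots> \<le> 2 * (2 ^ n * s) powr p" using sum_geometric_powr[OF p s, of n] by simp
    also have "\<dots> \<le> 2 * Y powr p" using True s p by (intro mult_left_mono powr_mono2) auto
    finally show ?thesis .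
  qed (use Suc in simp)
qed simp

text \<open>Every slice may use its own approximant, with a tolerance proportional to its height, so
  coarse nets suffice for high slices. The slice errors form a geometric series dominated by its top
  term, of order \<open>\<bar>y\<bar> powr p\<close>; the summand \<open>s\<close> is what lies
  below the lowest slice.\<close>

lemma abs_powr_approx_levels:
  assumes p: "1 \<le> p" "p \<le> 2" and s: "0 < s" "s \<le> 1" and \<eta>: "0 \<le> \<eta>" "\<eta> \<le> 1/2"
    and y: "\<bar>y\<bar> \<le> 2 ^ n * s" and z: "\<And>k. k < n \<Longrightarrow> \<bar>y - z k\<bar> \<le> \<eta> * (2 ^ k * s)"
  shows "\<bar>\<bar>y\<bar> powr p - (\<Sum>k<n. level p (2 ^ k * s) (z k))\<bar> \<le> 48 * \<eta> * \<bar>y\<bar> powr p + s"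
proof -
  have "\<bar>y\<bar> powr p = (\<Sum>k<n. level p (2 ^ k * s) y) + min \<bar>y\<bar> s powr p"
    using y by (simp add: sum_level)
  then have "\<bar>\<bar>y\<bar> powr p - (\<Sum>k<n. level p (2 ^ k * s) (z k))\<bar>
      \<le> \<bar>\<Sum>k<n. level p (2 ^ k * s) y - level p (2 ^ k * s) (z k)\<bar> + min \<bar>y\<bar> s powr p"
    using abs_triangle_ineq[of "(\<Sum>k<n. level p (2 ^ k * s) y - level p (2 ^ k * s) (z k))" "min \<bar>y\<bar> s powr p"]
    by (simp add: sum_subtractf algebra_simps)
  also have "min \<bar>y\<bar> s powr p \<le> s"
  proof -
    have "min \<bar>y\<bar> s powr p \<le> s powr p" using p s by (intro powr_mono2) auto
    also have "\<dots> \<le> s powr 1" using p s by (intro powr_mono') auto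
    finally show ?thesis using s by simp
  qed
  also have "\<bar>\<Sum>k<n. level p (2 ^ k * s) y - level p (2 ^ k * s) (z k)\<bar>
      \<le> (\<Sum>k<n. \<bar>level p (2 ^ k * s) y - level p (2 ^ k * s) (z k)\<bar>)" by (rule sum_abs)
  also have "\<dots> \<le> (\<Sum>k<n. if 2 ^ k * s \<le> 2 * \<bar>y\<bar> then 6 * \<eta> * (2 ^ k * s) powr p else 0)"
    using z s by (intro sum_mono level_perturb p \<eta>) auto
  also have "\<dots> = 6 * \<eta> * (\<Sum>k<n. if 2 ^ k * s \<le> 2 * \<bar>y\<bar> then (2 ^ k * s) powr p else 0)"
    unfolding sum_distrib_left by (intro sum.cong) auto
  also have "\<dots> \<le> 6 * \<eta> * (2 * (2 * \<bar>y\<bar>) powr p)"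
    using \<eta> by (intro mult_left_mono sum_geometric_powr_le p s) auto
  also have "\<dots> = 12 * \<eta> * (2 powr p * \<bar>y\<bar> powr p)" by (simp add: powr_mult)
  also have "\<dots> \<le> 12 * \<eta> * (4 * \<bar>y\<bar> powr p)"
    using \<eta> two_powr_le_four[of p] p by (intro mult_left_mono mult_right_mono) auto
  finally show ?thesis by simp
qed

section \<open>Sampling from an entropy bound\<close>

text \<open>The power \<open>u powr p\<close> matches the height of a slice, hence the denominator
  in Bernstein's exponent. The centres lie in \<open>F\<close>, so that they inherit its
  normalization and the mean of their slices is at most 1.\<close>

definition has_nets :: "('a \<Rightarrow> real) set \<Rightarrow> 'a set \<Rightarrow> real \<Rightarrow> real \<Rightarrow> real \<Rightarrow> bool" where
  "has_nets F S p B K \<longleftrightarrow> (\<forall>u. 0 < u \<longrightarrow> u \<le> B \<longrightarrow>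
     (\<exists>A\<subseteq>F. finite A \<and> real (card A) \<le> exp (K / u powr p) \<and>
        (\<forall>f\<in>F. \<exists>g\<in>A. \<forall>x\<in>S. \<bar>f x - g x\<bar> \<le> u)))"

text \<open>The constant 150994944 is \<open>1024 * 384\<^sup>2\<close>: the nets have relative precision \<open>\<epsilon> / 384\<close>, and each of
  the \<open>n\<close> slices is sampled to accuracy \<open>\<epsilon> / (8 * n)\<close>.\<close>
lemma discretize_unit_sphere:
  fixes F :: "('a \<Rightarrow> real) set"
  assumes M: "prob_space M" and p: "1 \<le> p" "p \<le> 2"
    and meas: "\<And>f. f \<in> F \<Longrightarrow> f \<in> borel_measurable M"
    and bd: "\<And>f x. f \<in> F \<Longrightarrow> x \<in> space M \<Longrightarrow> \<bar>f x\<bar> \<le> B"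
    and norm: "\<And>f. f \<in> F \<Longrightarrow> (\<integral>x. \<bar>f x\<bar> powr p \<partial>M) = 1"
    and nets: "has_nets F (space M) p B K" and K: "0 \<le> K"
    and \<epsilon>: "0 < \<epsilon>" "\<epsilon> \<le> 1" and n: "1 \<le> n" and nB: "B \<le> 2 ^ n * (\<epsilon> / 16)"
    and m: "150994944 * (real n)\<^sup>2 / \<epsilon> ^ 4 * (K + real n * B powr p) \<le> real m" "0 < m"
  obtains E where "E \<in> sets (Pi\<^sub>M {..<m} (\<lambda>_. M))" "measure (Pi\<^sub>M {..<m} (\<lambda>_. M)) E \<ge> 3 / 4"
    "\<And>\<xi> f. \<xi> \<in> E \<Longrightarrow> f \<in> F \<Longrightarrow> \<bar>(\<Sum>j<m. \<bar>f (\<xi> j)\<bar> powr p) / m - 1\<bar> \<le> \<epsilon>"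
proof -
  interpret prob_space M by fact
  \<comment> \<open>Error budget: \<open>48 * \<eta> = \<epsilon> / 8\<close> and \<open>s\<close>
    for replacing the power by slices, once on the space and once on the sample, and
    \<open>n * d = \<epsilon> / 8\<close> for the sampling. Together this is
    \<open>\<epsilon> / 2\<close>, up to a term that is absorbed at the end.\<close>
  define s where "s = \<epsilon> / 16"
  define \<eta> where "\<eta> = \<epsilon> / 384"
  define d where "d = \<epsilon> / (8 * real n)"
  have s: "0 < s" "s \<le> 1" using \<epsilon> by (auto simp: s_def)
  have \<eta>: "0 < \<eta>" "\<eta> \<le> 1/2" using \<epsilon> by (auto simp: \<eta>_def)
  have d: "0 < d" "d \<le> 2" using \<epsilon> n by (auto simp: d_def field_simps)
  have "\<exists>A\<subseteq>F. finite A \<and> real (card A) \<le> exp (K / (\<eta> * (2 ^ k * s)) powr p) \<and>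
        (\<forall>f\<in>F. \<exists>g\<in>A. \<forall>x\<in>space M. \<bar>f x - g x\<bar> \<le> \<eta> * (2 ^ k * s))" if "2 ^ k * s < B" for k
  proof -
    have "\<eta> * (2 ^ k * s) \<le> 1 * (2 ^ k * s)" using \<eta> s by (intro mult_right_mono) auto
    also have "\<dots> \<le> B" using that by simp
    finally have "0 < \<eta> * (2 ^ k * s)" "\<eta> * (2 ^ k * s) \<le> B"
      using \<eta> s by simp_all
    then show ?thesis using nets unfolding has_nets_def by blast
  qed
  then obtain A where A: "\<And>k. 2 ^ k * s < B \<Longrightarrow> A k \<subseteq> F \<and> finite (A k) \<and>
       real (card (A k)) \<le> exp (K / (\<eta> * (2 ^ k * s)) powr p) \<and>
        (\<forall>f\<in>F. \<exists>g\<in>A k. \<forall>x\<in>space M. \<bar>f x - g x\<bar> \<le> \<eta> * (2 ^ k * s))"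
    by metis
  \<comment> \<open>Slices of height at least \<open>B\<close> vanish on \<open>F\<close>, so only
    the others need nets; there \<open>f\<close> will serve as its own approximant.\<close>
  define L where "L = {k. k < n \<and> 2 ^ k * s < B}"
  have finL: "finite L" "card L \<le> n"
    using card_mono[of "{..<n}" L] by (auto simp: L_def)
  define I where "I = Sigma L A"
  define a where "a = (\<lambda>(k, g :: 'a \<Rightarrow> real) x. level p (2 ^ k * s) (g x))"
  define b where "b = (\<lambda>(k, g :: 'a \<Rightarrow> real). 4 * (2 ^ k * s) powr p)"
  have I: "finite I" unfolding I_def using finL A by (intro finite_SigmaI) (auto simp: L_def)
  have intF: "integrable M (\<lambda>x. \<bar>f x\<bar> powr p)" if "f \<in> F" for f
  proof (rule integrable_const_bound[where B="B powr p"])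
    show "AE x in M. norm (\<bar>f x\<bar> powr p) \<le> B powr p"
      using bd[OF that] p by (intro AE_I2) (auto intro!: powr_mono2)
    show "(\<lambda>x. \<bar>f x\<bar> powr p) \<in> borel_measurable M"
      using meas[OF that] by measurable
  qed
  have intL: "integrable M (\<lambda>x. level p (2 ^ k * s) (f x))" if "f \<in> F" for f k
  proof (rule integrable_const_bound[where B="4 * (2 ^ k * s) powr p"])
    show "AE x in M. norm (level p (2 ^ k * s) (f x)) \<le> 4 * (2 ^ k * s) powr p"
      using level_nonneg[of p "2 ^ k * s"] level_le[of p "2 ^ k * s"] p s by (intro AE_I2) auto
    show "(\<lambda>x. level p (2 ^ k * s) (f x)) \<in> borel_measurable M"
      using meas[OF that] by measurable
  qed
  have one: "2 * (card (A k) * exp (- (real m * d\<^sup>2 / (4 * (4 * (2 ^ k * s) powr p))))) \<le> 1 / (4 * real n)"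
    if "k \<in> L" for k
  proof -
    define t where "t = (2 ^ k * s) powr p"
    have t: "0 < t" "t \<le> B powr p"
      using that s p by (auto simp: t_def L_def intro!: powr_mono2)
    \<comment> \<open>Since \<open>\<eta> \<le> 1\<close>, the exponent \<open>p\<close> of the
      precision may be raised to 2; with the \<open>\<epsilon>\<^sup>2\<close> in
      \<open>d\<^sup>2\<close> this produces \<open>\<epsilon> ^ 4\<close>.\<close>
    have "(\<epsilon> / 384)\<^sup>2 \<le> \<eta> powr p"
      using powr_mono'[of p 2 \<eta>] p \<eta> by (simp add: \<eta>_def powr_realpow)
    then have "K / \<eta> powr p \<le> K / (\<epsilon> / 384)\<^sup>2"
      using K \<epsilon> \<eta> by (intro divide_left_mono) auto
    also have "\<dots> = 147456 * K / \<epsilon>\<^sup>2" by (simp add: power_divide)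
    finally have K': "K / \<eta> powr p \<le> 147456 * K / \<epsilon>\<^sup>2" .
    have "147456 * K / \<epsilon>\<^sup>2 + 8 * real n * B powr p
        \<le> 147456 * K / \<epsilon>\<^sup>2 + 147456 * (real n * B powr p) / \<epsilon>\<^sup>2"
    proof -
      have "8 * (real n * B powr p) \<le> (147456 / \<epsilon>\<^sup>2) * (real n * B powr p)"
        using \<epsilon> power_le_one[of \<epsilon> 2] by (intro mult_right_mono) (auto simp: field_simps)
      then show ?thesis by simp
    qed
    also have "\<dots> = (150994944 * (real n)\<^sup>2 / \<epsilon> ^ 4 * (K + real n * B powr p)) * (\<epsilon>\<^sup>2 / (1024 * (real n)\<^sup>2))"
      using \<epsilon> n by (simp add: field_simps power2_eq_square power4_eq_xxxx)
    also have "\<dots> \<le> real m * (\<epsilon>\<^sup>2 / (1024 * (real n)\<^sup>2))"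
      by (rule mult_right_mono[OF m(1)]) simp
    also have "\<dots> = real m * d\<^sup>2 / 16" by (simp add: d_def power_divide power_mult_distrib)
    finally have big: "K / \<eta> powr p + 8 * real n * t \<le> real m * d\<^sup>2 / 16"
      using K' mult_left_mono[OF t(2), of "8 * real n"] by linarith
    \<comment> \<open>The logarithm of the net size and Bernstein's exponent both carry the factor
      \<open>1 / t\<close>, so the single inequality \<open>big\<close> serves all heights. Its
      surplus \<open>8 * real n * t\<close> pays for the sum over the slices.\<close>
    have "K / (\<eta> * (2 ^ k * s)) powr p = (K / \<eta> powr p) / t"
      using \<eta> s by (simp add: t_def powr_mult)
    moreover have "real m * d\<^sup>2 / (4 * (4 * t)) = (real m * d\<^sup>2 / 16) / t" by simp
    ultimately have "K / (\<eta> * (2 ^ k * s)) powr p - real m * d\<^sup>2 / (4 * (4 * t))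
        = (K / \<eta> powr p - real m * d\<^sup>2 / 16) / t" by (simp add: diff_divide_distrib)
    also have "\<dots> \<le> - (8 * real n)" using big t by (simp add: field_simps)
    finally have ex: "K / (\<eta> * (2 ^ k * s)) powr p - real m * d\<^sup>2 / (4 * (4 * t)) \<le> - (8 * real n)" .
    have "card (A k) * exp (- (real m * d\<^sup>2 / (4 * (4 * t))))
        \<le> exp (K / (\<eta> * (2 ^ k * s)) powr p) * exp (- (real m * d\<^sup>2 / (4 * (4 * t))))"
      using A that by (intro mult_right_mono) (auto simp: L_def)
    also have "\<dots> \<le> exp (- (8 * real n))" using ex by (simp add: exp_add[symmetric])
    also have "\<dots> \<le> 1 / (8 * real n)"
    proof -
      have "8 * real n \<le> exp (8 * real n)" using exp_ge_add_one_self[of "8 * real n"] by linarith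
      then show ?thesis using n by (simp add: exp_minus divide_simps)
    qed
    finally show ?thesis by (simp add: t_def)
  qed
  have "(\<Sum>i\<in>I. 2 * exp (- (real m * d\<^sup>2 / (4 * b i))))
      = (\<Sum>k\<in>L. \<Sum>g\<in>A k. 2 * exp (- (real m * d\<^sup>2 / (4 * (4 * (2 ^ k * s) powr p)))))"
    unfolding I_def b_def using finL A by (subst sum.Sigma) (auto simp: L_def intro!: sum.cong)
  also have "\<dots> = (\<Sum>k\<in>L. 2 * (card (A k) * exp (- (real m * d\<^sup>2 / (4 * (4 * (2 ^ k * s) powr p))))))"
    by (simp add: algebra_simps)
  also have "\<dots> \<le> (\<Sum>k\<in>L. 1 / (4 * real n))" by (intro sum_mono one)
  also have "\<dots> \<le> 1 / 4" using finL n by (simp add: field_simps)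
  finally have small: "(\<Sum>i\<in>I. 2 * exp (- (real m * d\<^sup>2 / (4 * b i)))) \<le> 1 / 4" .
  obtain E where E: "E \<in> sets (Pi\<^sub>M {..<m} (\<lambda>_. M))" "measure (Pi\<^sub>M {..<m} (\<lambda>_. M)) E \<ge> 1 - 1 / 4"
    "\<And>\<xi> i. \<xi> \<in> E \<Longrightarrow> i \<in> I \<Longrightarrow> \<bar>(\<Sum>j<m. a i (\<xi> j)) / m - (\<integral>x. a i x \<partial>M)\<bar> \<le> d"
  proof (rule simultaneous_sampling[OF M I, of a b d m "1 / 4"])
    fix i assume "i \<in> I"
    then obtain k g where i: "i = (k, g)" "k \<in> L" "g \<in> F" using A unfolding I_def L_def by blast
    show "a i \<in> borel_measurable M" using meas[OF i(3)] unfolding a_def i split by measurable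
    show "0 < b i" using i s by (simp add: b_def)
    show "0 \<le> a i x \<and> a i x \<le> b i" for x
      using level_nonneg[of p "2 ^ k * s"] level_le[of p "2 ^ k * s"] p s by (auto simp: a_def b_def i)
    have "(\<integral>x. a i x \<partial>M) \<le> (\<integral>x. \<bar>g x\<bar> powr p \<partial>M)"
      using intL[OF i(3), of k] intF[OF i(3)] level_le_abs_powr[of p "2 ^ k * s"] p s
      by (intro integral_mono) (auto simp: a_def i)
    then show "(\<integral>x. a i x \<partial>M) \<le> 1" using norm[OF i(3)] by simp
  qed (use d m small in auto)
  show thesis
  proof (rule that[of E])
    fix \<xi> f assume \<xi>: "\<xi> \<in> E" and f: "f \<in> F"
    have sp: "\<xi> j \<in> space M" if "j < m" for j
      using \<xi> E(1) sets.sets_into_space that by (fastforce simp: space_PiM PiE_def Pi_def)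
    have "\<exists>h. h \<in> F \<and> (\<forall>x\<in>space M. \<bar>f x - h x\<bar> \<le> \<eta> * (2 ^ k * s)) \<and>
        \<bar>(\<Sum>j<m. level p (2 ^ k * s) (h (\<xi> j))) / m - (\<integral>x. level p (2 ^ k * s) (h x) \<partial>M)\<bar> \<le> d"
      if "k < n" for k
    proof (cases "2 ^ k * s < B")
      case True
      then obtain h where h: "h \<in> A k" "\<forall>x\<in>space M. \<bar>f x - h x\<bar> \<le> \<eta> * (2 ^ k * s)"
        using A f by blast
      then have "(k, h) \<in> I" using that True by (auto simp: I_def L_def)
      from E(3)[OF \<xi> this] h A[OF True] show ?thesis by (auto simp: a_def)
    next
      case False
      have "level p (2 ^ k * s) (f x) = 0" if "x \<in> space M" for x
        using bd[OF f that] False s by (intro level_eq_0) auto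
      moreover from this have "(\<integral>x. level p (2 ^ k * s) (f x) \<partial>M) = (\<integral>x. 0 \<partial>M)"
        by (intro Bochner_Integration.integral_cong) auto
      ultimately show ?thesis using f \<eta> s d sp by (intro exI[of _ f]) auto
    qed
    then obtain h where h: "\<And>k. k < n \<Longrightarrow> h k \<in> F"
      "\<And>k x. k < n \<Longrightarrow> x \<in> space M \<Longrightarrow> \<bar>f x - h k x\<bar> \<le> \<eta> * (2 ^ k * s)"
      "\<And>k. k < n \<Longrightarrow> \<bar>(\<Sum>j<m. level p (2 ^ k * s) (h k (\<xi> j))) / m - (\<integral>x. level p (2 ^ k * s) (h k x) \<partial>M)\<bar> \<le> d"
      by metis
    define S where "S x = (\<Sum>k<n. level p (2 ^ k * s) (h k x))" for x
    have pw: "\<bar>\<bar>f x\<bar> powr p - S x\<bar> \<le> \<epsilon> / 8 * \<bar>f x\<bar> powr p + \<epsilon> / 16" if "x \<in> space M" for x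
      using abs_powr_approx_levels[OF p s _ \<eta>(2), of "f x" n "\<lambda>k. h k x"] \<eta> h(2)[OF _ that] bd[OF f that] nB
      unfolding S_def by (simp add: \<eta>_def s_def)
    have intS: "integrable M S" unfolding S_def using intL h(1) by (intro Bochner_Integration.integrable_sum) auto
    have "\<bar>1 - (\<integral>x. S x \<partial>M)\<bar> = \<bar>\<integral>x. (\<bar>f x\<bar> powr p - S x) \<partial>M\<bar>"
      using intF[OF f] intS norm[OF f] by simp
    also have "\<dots> \<le> (\<integral>x. \<bar>\<bar>f x\<bar> powr p - S x\<bar> \<partial>M)" by (rule integral_abs_bound)
    also have "\<dots> \<le> (\<integral>x. \<epsilon> / 8 * \<bar>f x\<bar> powr p + \<epsilon> / 16 \<partial>M)"
      using intF[OF f] intS pw by (intro integral_mono) auto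
    also have "\<dots> = \<epsilon> / 8 + \<epsilon> / 16" using intF[OF f] norm[OF f] by (simp add: prob_space)
    finally have E1: "\<bar>1 - (\<integral>x. S x \<partial>M)\<bar> \<le> \<epsilon> / 8 + \<epsilon> / 16" .
    define X where "X = (\<Sum>j<m. \<bar>f (\<xi> j)\<bar> powr p) / m"
    have "\<bar>X - (\<Sum>j<m. S (\<xi> j)) / m\<bar> = \<bar>\<Sum>j<m. \<bar>f (\<xi> j)\<bar> powr p - S (\<xi> j)\<bar> / m"
      by (simp add: X_def sum_subtractf diff_divide_distrib[symmetric])
    also have "\<dots> \<le> (\<Sum>j<m. \<epsilon> / 8 * \<bar>f (\<xi> j)\<bar> powr p + \<epsilon> / 16) / m"
      using pw[OF sp] by (intro divide_right_mono order_trans[OF sum_abs] sum_mono) auto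
    also have "\<dots> = \<epsilon> / 8 * X + \<epsilon> / 16"
      using m by (simp add: X_def sum.distrib add_divide_distrib sum_distrib_left sum_divide_distrib)
    finally have E2: "\<bar>X - (\<Sum>j<m. S (\<xi> j)) / m\<bar> \<le> \<epsilon> / 8 * X + \<epsilon> / 16" .
    have "(\<Sum>j<m. S (\<xi> j)) / m = (\<Sum>k<n. (\<Sum>j<m. level p (2 ^ k * s) (h k (\<xi> j))) / m)"
      unfolding S_def by (subst sum.swap) (simp add: sum_divide_distrib)
    moreover have "(\<integral>x. S x \<partial>M) = (\<Sum>k<n. \<integral>x. level p (2 ^ k * s) (h k x) \<partial>M)"
      unfolding S_def using intL h(1) by (intro Bochner_Integration.integral_sum) auto
    ultimately have "\<bar>(\<Sum>j<m. S (\<xi> j)) / m - (\<integral>x. S x \<partial>M)\<bar> \<le> (\<Sum>k<n. d)"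
      using h(3) by (simp only: sum_subtractf[symmetric]) (intro order_trans[OF sum_abs] sum_mono, auto)
    also have "\<dots> = \<epsilon> / 8" using n by (simp add: d_def)
    finally have E3: "\<bar>(\<Sum>j<m. S (\<xi> j)) / m - (\<integral>x. S x \<partial>M)\<bar> \<le> \<epsilon> / 8" .
    \<comment> \<open>The error on the sample is relative to \<open>X\<close>, which is the quantity
      to be bounded. It is expressed by \<open>\<bar>X - 1\<bar>\<close> with a factor 1/8 and
      absorbed on the left.\<close>
    have "\<epsilon> / 8 * X \<le> \<epsilon> / 8 * (1 + \<bar>X - 1\<bar>)" using \<epsilon> by (intro mult_left_mono) auto
    also have "\<dots> \<le> \<epsilon> / 8 + 1 / 8 * \<bar>X - 1\<bar>"
      using \<epsilon> mult_right_mono[of "\<epsilon> / 8" "1 / 8" "\<bar>X - 1\<bar>"] by (simp add: algebra_simps)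
    finally have "\<epsilon> / 8 * X \<le> \<epsilon> / 8 + 1 / 8 * \<bar>X - 1\<bar>" .
    then have X: "\<epsilon> / 8 * X + \<epsilon> / 16 + \<epsilon> / 8 + (\<epsilon> / 8 + \<epsilon> / 16) \<le> \<epsilon> / 2 + 1 / 8 * \<bar>X - 1\<bar>" by simp
    have "\<bar>X - 1\<bar> \<le> \<bar>X - (\<Sum>j<m. S (\<xi> j)) / m\<bar> + \<bar>(\<Sum>j<m. S (\<xi> j)) / m - (\<integral>x. S x \<partial>M)\<bar>
        + \<bar>1 - (\<integral>x. S x \<partial>M)\<bar>" by linarith
    also have "\<dots> \<le> \<epsilon> / 8 * X + \<epsilon> / 16 + \<epsilon> / 8 + (\<epsilon> / 8 + \<epsilon> / 16)" by (intro add_mono E1 E2 E3)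
    also note X
    finally have "\<bar>X - 1\<bar> \<le> \<epsilon> / 2 + 1 / 8 * \<bar>X - 1\<bar>" .
    moreover have "D \<le> \<epsilon>" if "D \<le> \<epsilon> / 2 + 1 / 8 * D" for D using that \<epsilon> by simp
    ultimately show "\<bar>(\<Sum>j<m. \<bar>f (\<xi> j)\<bar> powr p) / m - 1\<bar> \<le> \<epsilon>"
      unfolding X_def[symmetric] by blast
  qed (use E in auto)
qed

section \<open>Sparse combinations of a bounded system\<close>

definition lincomb :: "nat \<Rightarrow> (nat \<Rightarrow> 'a \<Rightarrow> real) \<Rightarrow> (nat \<Rightarrow> real) \<Rightarrow> 'a \<Rightarrow> real" where
  "lincomb N \<phi> c x = (\<Sum>j=1..N. c j * \<phi> j x)"

lemma lincomb_diff: "lincomb N \<phi> (\<lambda>j. c j - d j) x = lincomb N \<phi> c x - lincomb N \<phi> d x"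
  by (simp add: lincomb_def sum_subtractf left_diff_distrib)

lemma lincomb_scale: "lincomb N \<phi> (\<lambda>j. a * c j) x = a * lincomb N \<phi> c x"
  by (simp add: lincomb_def sum_distrib_left mult.assoc)

lemma abs_lincomb_le:
  assumes "\<And>j. j \<in> {1..N} \<Longrightarrow> \<bar>\<phi> j x\<bar> \<le> 1"
  shows "\<bar>lincomb N \<phi> c x\<bar> \<le> (\<Sum>j=1..N. \<bar>c j\<bar>)"
proof -
  have "\<bar>lincomb N \<phi> c x\<bar> \<le> (\<Sum>j=1..N. \<bar>c j * \<phi> j x\<bar>)"
    unfolding lincomb_def by (rule sum_abs)
  also have "\<dots> \<le> (\<Sum>j=1..N. \<bar>c j\<bar> * 1)"
    unfolding abs_mult using assms by (intro sum_mono mult_left_mono) auto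
  finally show ?thesis by simp
qed

text \<open>Counting nonzero coefficients instead of fixing an index set makes sparsity subadditive
  under differences and invariant under scaling.\<close>

definition coeffs_on :: "nat \<Rightarrow> (nat \<Rightarrow> real) \<Rightarrow> nat set" where
  "coeffs_on N c = {j\<in>{1..N}. c j \<noteq> 0}"

lemma finite_coeffs_on [simp]: "finite (coeffs_on N c)"
  by (simp add: coeffs_on_def)

text \<open>Cauchy-Schwarz against the indicator of the support.\<close>

lemma sum_abs_sq_le_card:
  "(\<Sum>j=1..N. \<bar>c j\<bar>)\<^sup>2 \<le> real (card (coeffs_on N c)) * (\<Sum>j=1..N. (c j)\<^sup>2)"
proof -
  have "(\<Sum>j=1..N. \<bar>c j\<bar>) = (\<Sum>j=1..N. of_bool (c j \<noteq> 0) * \<bar>c j\<bar>)"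
    by (intro sum.cong) auto
  then have "(\<Sum>j=1..N. \<bar>c j\<bar>)\<^sup>2 \<le> (\<Sum>j=1..N. (of_bool (c j \<noteq> 0))\<^sup>2) * (\<Sum>j=1..N. \<bar>c j\<bar>\<^sup>2)"
    using Cauchy_Schwarz_ineq_sum[of "\<lambda>j. of_bool (c j \<noteq> 0)" "\<lambda>j. \<bar>c j\<bar>" "{1..N}"] by simp
  also have "(\<Sum>j=1..N. (of_bool (c j \<noteq> 0))\<^sup>2 :: real) = real (card (coeffs_on N c))"
    by (simp add: coeffs_on_def sum_of_bool_eq power2_eq_square Int_def)
  finally show ?thesis by simp
qed

lemma card_coeffs_on_diff:
  "card (coeffs_on N (\<lambda>j. c j - d j)) \<le> card (coeffs_on N c) + card (coeffs_on N d)"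
proof -
  have "coeffs_on N (\<lambda>j. c j - d j) \<subseteq> coeffs_on N c \<union> coeffs_on N d"
    by (auto simp: coeffs_on_def)
  then show ?thesis by (meson card_Un_le card_mono finite_UnI finite_coeffs_on order_trans)
qed

text \<open>Instantiated both by the given space without a null set and by the uniform measure on
  the indices of a sample. The bound holds at every point because functions are evaluated at
  individual sample points.\<close>

locale bounded_system = prob_space M for M :: "'a measure" +
  fixes \<phi> :: "nat \<Rightarrow> 'a \<Rightarrow> real" and N :: nat and r :: real
  assumes N: "1 \<le> N"
    and meas [measurable]: "j \<in> {1..N} \<Longrightarrow> \<phi> j \<in> borel_measurable M"
    and bound: "j \<in> {1..N} \<Longrightarrow> x \<in> space M \<Longrightarrow> \<bar>\<phi> j x\<bar> \<le> 1"
    and r: "0 < r" "r \<le> 1"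
    and lower: "r\<^sup>2 * (\<Sum>j=1..N. (c j)\<^sup>2) \<le> (\<integral>x. (lincomb N \<phi> c x)\<^sup>2 \<partial>M)"
begin

lemma lincomb_measurable [measurable]: "lincomb N \<phi> c \<in> borel_measurable M"
  unfolding lincomb_def[abs_def] by measurable

lemma lincomb_bound: "x \<in> space M \<Longrightarrow> \<bar>lincomb N \<phi> c x\<bar> \<le> (\<Sum>j=1..N. \<bar>c j\<bar>)"
  using bound by (intro abs_lincomb_le) auto

lemma integrable_powr:
  assumes "0 \<le> q"
  shows "integrable M (\<lambda>x. \<bar>lincomb N \<phi> c x\<bar> powr q)"
proof (rule integrable_const_bound[where B="(\<Sum>j=1..N. \<bar>c j\<bar>) powr q"])
  show "AE x in M. norm (\<bar>lincomb N \<phi> c x\<bar> powr q) \<le> (\<Sum>j=1..N. \<bar>c j\<bar>) powr q"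
    using lincomb_bound[of _ c] assms by (intro AE_I2) (auto intro!: powr_mono2)
qed measurable

lemma integrable_sq: "integrable M (\<lambda>x. (lincomb N \<phi> c x)\<^sup>2)"
proof -
  have "(\<lambda>x. \<bar>lincomb N \<phi> c x\<bar> powr 2) = (\<lambda>x. (lincomb N \<phi> c x)\<^sup>2)"
    by (auto simp: fun_eq_iff powr_numeral)
  then show ?thesis using integrable_powr[of 2 c] by simp
qed

text \<open>The \<open>L\<^sub>2\<close> norm is interpolated between \<open>L\<^sub>p\<close> and the sup norm.\<close>
lemma sum_abs_sq_le:
  assumes p: "1 \<le> p" "p \<le> 2" and U: "\<And>x. x \<in> space M \<Longrightarrow> \<bar>lincomb N \<phi> c x\<bar> \<le> U"
    and w: "card (coeffs_on N c) \<le> w"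
  shows "(\<Sum>j=1..N. \<bar>c j\<bar>)\<^sup>2
    \<le> real w / r\<^sup>2 * (U powr (2 - p) * (\<integral>x. \<bar>lincomb N \<phi> c x\<bar> powr p \<partial>M))"
proof -
  have "r\<^sup>2 * (\<Sum>j=1..N. (c j)\<^sup>2) \<le> (\<integral>x. (lincomb N \<phi> c x)\<^sup>2 \<partial>M)" by (rule lower)
  also have "\<dots> \<le> (\<integral>x. U powr (2 - p) * \<bar>lincomb N \<phi> c x\<bar> powr p \<partial>M)"
  proof (rule integral_mono[OF integrable_sq])
    show "integrable M (\<lambda>x. U powr (2 - p) * \<bar>lincomb N \<phi> c x\<bar> powr p)"
      using integrable_powr p by (intro integrable_mult_right) auto
    fix x assume x: "x \<in> space M"
    have "(lincomb N \<phi> c x)\<^sup>2 = \<bar>lincomb N \<phi> c x\<bar> powr (2 - p) * \<bar>lincomb N \<phi> c x\<bar> powr p"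
      by (simp add: powr_add[symmetric] powr_numeral)
    also have "\<dots> \<le> U powr (2 - p) * \<bar>lincomb N \<phi> c x\<bar> powr p"
      using U[OF x] p by (intro mult_right_mono powr_mono2) auto
    finally show "(lincomb N \<phi> c x)\<^sup>2 \<le> U powr (2 - p) * \<bar>lincomb N \<phi> c x\<bar> powr p" .
  qed
  finally have "(\<Sum>j=1..N. (c j)\<^sup>2) \<le> (U powr (2 - p) * (\<integral>x. \<bar>lincomb N \<phi> c x\<bar> powr p \<partial>M)) / r\<^sup>2"
    using r by (simp add: field_simps)
  then have "real w * (\<Sum>j=1..N. (c j)\<^sup>2)
      \<le> real w * ((U powr (2 - p) * (\<integral>x. \<bar>lincomb N \<phi> c x\<bar> powr p \<partial>M)) / r\<^sup>2)"
    by (rule mult_left_mono) simp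
  moreover have "real (card (coeffs_on N c)) * (\<Sum>j=1..N. (c j)\<^sup>2) \<le> real w * (\<Sum>j=1..N. (c j)\<^sup>2)"
    using w by (intro mult_right_mono sum_nonneg) auto
  ultimately show ?thesis using sum_abs_sq_le_card[of c N] by simp
qed

definition sphere_coeffs :: "nat \<Rightarrow> real \<Rightarrow> (nat \<Rightarrow> real) set" where
  "sphere_coeffs w p = {c. card (coeffs_on N c) \<le> w \<and> (\<integral>x. \<bar>lincomb N \<phi> c x\<bar> powr p \<partial>M) = 1}"

text \<open>A Nikolskii-type constant, bounding the sup norm on the unit \<open>L_p\<close> sphere
  of \<open>w\<close>-sparse functions. Its \<open>p\<close>-th power is linear in \<open>w\<close>,
  hence the linear dependence of the sample size on the sparsity.\<close>

definition radius :: "nat \<Rightarrow> real \<Rightarrow> real" where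
  "radius w p = (real w / r\<^sup>2) powr (1 / p)"

lemma radius_powr: "1 \<le> p \<Longrightarrow> radius w p powr p = real w / r\<^sup>2"
  by (simp add: radius_def powr_powr)

lemma radius_pos: "1 \<le> w \<Longrightarrow> 0 < radius w p"
  using r by (simp add: radius_def)

text \<open>A bootstrap: the coefficient sum \<open>S\<close> dominates the sup norm, so
  interpolation with \<open>U = S\<close> bounds \<open>S\<^sup>2\<close> by
  \<open>w / r\<^sup>2\<close> times \<open>S powr (2 - p)\<close>, and the power of
  \<open>S\<close> cancels.\<close>

lemma sum_abs_le_radius:
  assumes p: "1 \<le> p" "p \<le> 2" and c: "c \<in> sphere_coeffs w p"
  shows "(\<Sum>j=1..N. \<bar>c j\<bar>) \<le> radius w p"
proof (cases "(\<Sum>j=1..N. \<bar>c j\<bar>) = 0")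
  case True
  then show ?thesis by (simp add: radius_def)
next
  case False
  define S where "S = (\<Sum>j=1..N. \<bar>c j\<bar>)"
  have S: "0 < S" using False sum_nonneg[of "{1..N}" "\<lambda>j. \<bar>c j\<bar>"] by (auto simp: S_def less_le)
  have "S\<^sup>2 \<le> real w / r\<^sup>2 * (S powr (2 - p) * 1)"
    using sum_abs_sq_le[OF p, of c S w] lincomb_bound c unfolding S_def sphere_coeffs_def by simp
  moreover have "S\<^sup>2 = S powr (2 - p) * S powr p"
    using S by (simp add: powr_add[symmetric] powr_numeral)
  ultimately have "S powr (2 - p) * S powr p \<le> S powr (2 - p) * (real w / r\<^sup>2)" by (simp add: mult.commute)
  then have "S powr p \<le> real w / r\<^sup>2" by (rule mult_left_le_imp_le) (use S in simp)
  then have "(S powr p) powr (1 / p) \<le> radius w p"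
    unfolding radius_def using p by (intro powr_mono2) auto
  then show ?thesis using S p unfolding S_def[symmetric] by (simp add: powr_powr)
qed

lemma lincomb_le_radius:
  assumes "1 \<le> p" "p \<le> 2" "c \<in> sphere_coeffs w p" "x \<in> space M"
  shows "\<bar>lincomb N \<phi> c x\<bar> \<le> radius w p"
  using lincomb_bound[OF assms(4), of c] sum_abs_le_radius[OF assms(1-3)] by linarith

end

text \<open>One representative per code keeps the net inside the class. The price is that equal
  codes must make two members of the class close to each other.\<close>

lemma net_from_code:
  assumes "finite T" and "code ` C \<subseteq> T"
    and "\<And>c c'. c \<in> C \<Longrightarrow> c' \<in> C \<Longrightarrow> code c = code c' \<Longrightarrow> close (e c) (e c')"
  shows "\<exists>A\<subseteq>e ` C. finite A \<and> card A \<le> card T \<and> (\<forall>f\<in>e ` C. \<exists>g\<in>A. close f g)"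
proof (intro exI[of _ "(\<lambda>t. e (inv_into C code t)) ` (code ` C)"] conjI ballI)
  have fin: "finite (code ` C)" using assms finite_subset by blast
  then show "finite ((\<lambda>t. e (inv_into C code t)) ` (code ` C))" by simp
  have "card ((\<lambda>t. e (inv_into C code t)) ` (code ` C)) \<le> card (code ` C)"
    using fin by (rule card_image_le)
  also have "\<dots> \<le> card T" using assms by (intro card_mono) auto
  finally show "card ((\<lambda>t. e (inv_into C code t)) ` (code ` C)) \<le> card T" .
  show "(\<lambda>t. e (inv_into C code t)) ` (code ` C) \<subseteq> e ` C"
    by (auto intro!: imageI inv_into_into)
  fix f assume "f \<in> e ` C"
  then obtain c where c: "c \<in> C" "f = e c" by auto
  have "close f (e (inv_into C code (code c)))"
    unfolding c using c by (intro assms(3)) (auto simp: f_inv_into_f inv_into_into)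
  then show "\<exists>g\<in>(\<lambda>t. e (inv_into C code t)) ` (code ` C). close f g" using c by auto
qed

context bounded_system
begin

text \<open>Coefficients are rounded on a grid of mesh \<open>u / N\<close>. The logarithm of the
  count is overestimated by a linear function of \<open>B / u\<close>, then by its
  \<open>p\<close>-th power since \<open>B / u \<ge> 1\<close>. Only polynomial dependence on
  \<open>N\<close> matters here.\<close>

lemma crude_nets:
  assumes p: "1 \<le> p" "p \<le> 2"
  shows "has_nets (lincomb N \<phi> ` sphere_coeffs N p) (space M) p (radius N p) (5 * real N ^ 3 / r\<^sup>2)"
  unfolding has_nets_def
proof (intro allI impI)
  fix u assume u: "0 < u" "u \<le> radius N p"
  define B where "B = radius N p"
  define q where "q = real N / u"
  define k where "k = \<lceil>B * q\<rceil>"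
  have q: "0 < q" using u N by (simp add: q_def)
  have Bu: "1 \<le> B / u" using u by (simp add: B_def)
  have "1 * 1 \<le> B / u * real N" using Bu N by (intro mult_mono) auto
  then have Bq: "1 \<le> B * q" by (simp add: q_def)
  define code where "code c = (\<lambda>j\<in>{1..N}. \<lfloor>c j * q\<rfloor>)" for c :: "nat \<Rightarrow> real"
  define T where "T = PiE {1..N} (\<lambda>_. {-k..k})"
  have range: "code ` sphere_coeffs N p \<subseteq> T"
  proof
    fix t assume "t \<in> code ` sphere_coeffs N p"
    then obtain c where c: "c \<in> sphere_coeffs N p" and t: "t = code c" by auto
    have "\<lfloor>c j * q\<rfloor> \<in> {-k..k}" if j: "j \<in> {1..N}" for j
    proof -
      have "\<bar>c j\<bar> \<le> (\<Sum>j=1..N. \<bar>c j\<bar>)" using j by (intro member_le_sum) auto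
      also have "\<dots> \<le> B" unfolding B_def by (rule sum_abs_le_radius[OF p c])
      finally have "\<bar>c j * q\<bar> \<le> B * q" using q by (simp add: abs_mult)
      then have "- (B * q) \<le> c j * q" "c j * q \<le> B * q" by auto
      then show ?thesis unfolding k_def by (auto, linarith+)
    qed
    then show "t \<in> T" by (auto simp: t code_def T_def)
  qed
  have close: "\<forall>x\<in>space M. \<bar>lincomb N \<phi> c x - lincomb N \<phi> c' x\<bar> \<le> u" if eq: "code c = code c'" for c c'
  proof
    fix x assume x: "x \<in> space M"
    have "\<bar>c j - c' j\<bar> \<le> 1 / q" if "j \<in> {1..N}" for j
    proof -
      have "\<lfloor>c j * q\<rfloor> = \<lfloor>c' j * q\<rfloor>" using fun_cong[OF eq, of j] that by (simp add: code_def)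
      then have "\<bar>c j * q - c' j * q\<bar> \<le> 1" by linarith
      then have "\<bar>c j - c' j\<bar> * q \<le> 1" using q by (simp add: left_diff_distrib[symmetric] abs_mult)
      then show ?thesis using q by (simp add: field_simps)
    qed
    then have "(\<Sum>j=1..N. \<bar>c j - c' j\<bar>) \<le> (\<Sum>j=1..N. 1 / q)" by (intro sum_mono) auto
    also have "\<dots> = u" using N by (simp add: q_def)
    finally show "\<bar>lincomb N \<phi> c x - lincomb N \<phi> c' x\<bar> \<le> u"
      using lincomb_bound[OF x, of "\<lambda>j. c j - c' j"] unfolding lincomb_diff by linarith
  qed
  have "real (card T) = real_of_int (2 * k + 1) ^ N"
    using Bq by (simp add: T_def card_PiE k_def)
  also have "\<dots> \<le> (5 * (B * q)) ^ N"
    using Bq unfolding k_def by (intro power_mono) linarith+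
  also have "\<dots> \<le> exp (5 * (B * q)) ^ N"
    using Bq exp_ge_add_one_self[of "5 * (B * q)"] by (intro power_mono) linarith+
  also have "\<dots> = exp (5 * real N ^ 2 * (B / u))"
    by (simp add: exp_of_nat_mult[symmetric] q_def power2_eq_square algebra_simps)
  also have "\<dots> \<le> exp (5 * real N ^ 2 * (B / u) powr p)"
    using mult_left_mono[OF powr_mono[OF p(1) Bu], of "5 * real N ^ 2"] Bu u by simp
  also have "(B / u) powr p = (real N / r\<^sup>2) / u powr p"
    using u p radius_powr[of p N] by (simp add: powr_divide B_def)
  finally have "real (card T) \<le> exp (5 * real N ^ 3 / r\<^sup>2 / u powr p)"
    by (simp add: power2_eq_square power3_eq_cube mult.assoc)
  moreover have "finite T" by (simp add: T_def finite_PiE)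
  then obtain A where "A \<subseteq> lincomb N \<phi> ` sphere_coeffs N p" "finite A" "card A \<le> card T"
      "\<forall>f\<in>lincomb N \<phi> ` sphere_coeffs N p. \<exists>g\<in>A. \<forall>x\<in>space M. \<bar>f x - g x\<bar> \<le> u"
    using net_from_code[OF _ range, of "\<lambda>f g. \<forall>x\<in>space M. \<bar>f x - g x\<bar> \<le> u" "lincomb N \<phi>"] close by metis
  ultimately show "\<exists>A\<subseteq>lincomb N \<phi> ` sphere_coeffs N p. finite A \<and> real (card A) \<le> exp (5 * real N ^ 3 / r\<^sup>2 / u powr p) \<and>
      (\<forall>f\<in>lincomb N \<phi> ` sphere_coeffs N p. \<exists>g\<in>A. \<forall>x\<in>space M. \<bar>f x - g x\<bar> \<le> u)"
    by (intro exI[of _ A]) (auto intro: order_trans)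
qed

end

section \<open>Entropy of sparse functions on a finite space\<close>

text \<open>Maurey's empirical method: a point of the absolute convex hull of the \<open>\<phi> j\<close> is the mean
  of a random signed \<open>\<phi> j\<close>, so it is well approximated by an empirical average.\<close>
lemma maurey:
  fixes \<phi> :: "nat \<Rightarrow> 'a \<Rightarrow> real"
  assumes N: "1 \<le> N" and Y: "finite Y" and \<phi>: "\<And>j x. j \<in> {1..N} \<Longrightarrow> x \<in> Y \<Longrightarrow> \<bar>\<phi> j x\<bar> \<le> 1"
    and c: "(\<Sum>j=1..N. \<bar>c j\<bar>) \<le> b" and b: "0 < b" and t: "0 < t" "t \<le> 4 * b"
    and Z: "card Y \<le> Z" "1 \<le> Z" and l: "16 * (b / t)\<^sup>2 * ln (4 * real Z) \<le> real l" "0 < l"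
  shows "\<exists>\<tau>\<in>PiE {..<l} (\<lambda>_. {1..N} \<times> {1, -1}). \<forall>x\<in>Y.
    \<bar>lincomb N \<phi> c x - b * ((\<Sum>i<l. snd (\<tau> i) * \<phi> (fst (\<tau> i)) x) / real l)\<bar> \<le> t"
proof -
  define J where "J = {1..N} \<times> {1, -1 :: real}"
  \<comment> \<open>Index \<open>j\<close> with sign \<open>s\<close> gets the positive part of
    \<open>s * c j / b\<close>. The missing mass is spread evenly over both signs of every index, so
    it makes the total 1 without changing the mean.\<close>
  define w where "w = (\<lambda>(j, s). (\<bar>c j\<bar> + s * c j) / (2 * b) + (1 - (\<Sum>j=1..N. \<bar>c j\<bar>) / b) / (2 * real N))"
  have J: "finite J" by (simp add: J_def)
  have sumJ: "(\<Sum>i\<in>J. g i) = (\<Sum>j=1..N. g (j, 1) + g (j, -1))" for g :: "nat \<times> real \<Rightarrow> real"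
  proof -
    have "(\<Sum>i\<in>J. g i) = (\<Sum>j=1..N. \<Sum>s\<in>{1, -1}. g (j, s))"
      unfolding J_def by (subst sum.cartesian_product) simp
    then show ?thesis by simp
  qed
  have w0: "0 \<le> w i" if "i \<in> J" for i
  proof -
    have "0 \<le> 1 - (\<Sum>j=1..N. \<bar>c j\<bar>) / b" using c b by (simp add: field_simps)
    moreover have "0 \<le> \<bar>c (fst i)\<bar> + snd i * c (fst i)" using that by (auto simp: J_def)
    ultimately show ?thesis using b by (auto simp: w_def split: prod.split)
  qed
  have "(\<Sum>i\<in>J. w i) = (\<Sum>j=1..N. \<bar>c j\<bar> / b + (1 - (\<Sum>j=1..N. \<bar>c j\<bar>) / b) / real N)"
    unfolding sumJ using b N by (intro sum.cong) (auto simp: w_def field_simps)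
  also have "\<dots> = 1" using N by (simp add: sum.distrib sum_divide_distrib)
  finally have w1: "(\<Sum>i\<in>J. w i) = 1" .
  have prob: "prob_space (point_measure J w)"
  proof (rule prob_space_point_measure[OF J])
    show "(\<Sum>i\<in>J. ennreal (w i)) = 1" using w0 w1 by (subst sum_ennreal) auto
  qed simp
  have integral: "(\<integral>i. g i \<partial>point_measure J w) = (\<Sum>i\<in>J. w i * g i)" for g :: "nat \<times> real \<Rightarrow> real"
    by (subst lebesgue_integral_point_measure_finite) (use J w0 in auto)
  \<comment> \<open>The affine map of \<open>[-1, 1]\<close> onto \<open>[0, 1]\<close> meets the
    hypotheses of \<open>simultaneous_sampling\<close> with height 1; it turns the error
    \<open>t\<close> into \<open>t / (2 * b)\<close>.\<close>
  define a where "a = (\<lambda>x (j, s). (1 + s * \<phi> j x) / 2)"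
  have mean: "(\<integral>i. a x i \<partial>point_measure J w) = (1 + lincomb N \<phi> c x / b) / 2" for x
  proof -
    have "(\<integral>i. a x i \<partial>point_measure J w)
        = (\<Sum>i\<in>J. w i / 2) + (\<Sum>i\<in>J. w i * (snd i * \<phi> (fst i) x)) / 2"
      unfolding integral a_def
      by (simp add: sum.distrib[symmetric] sum_divide_distrib split_beta algebra_simps add_divide_distrib)
    also have "(\<Sum>i\<in>J. w i / 2) = 1 / 2" using w1 by (simp add: sum_divide_distrib[symmetric])
    also have "(\<Sum>i\<in>J. w i * (snd i * \<phi> (fst i) x)) = lincomb N \<phi> c x / b"
      unfolding sumJ lincomb_def sum_divide_distrib using b
      by (intro sum.cong) (auto simp: w_def algebra_simps add_divide_distrib diff_divide_distrib)
    finally show ?thesis by (simp add: add_divide_distrib)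
  qed
  have a01: "0 \<le> a x i \<and> a x i \<le> 1" if "x \<in> Y" "i \<in> J" for x i
    using \<phi>[of "fst i" x] that by (auto simp: a_def J_def abs_le_iff)
  \<comment> \<open>The size of \<open>l\<close> makes each of at most \<open>Z\<close> points fail
    with probability at most \<open>1 / (2 * Z)\<close>.\<close>
  have small: "(\<Sum>x\<in>Y. 2 * exp (- (real l * (t / (2 * b))\<^sup>2 / (4 * 1)))) \<le> 1 / 2"
  proof -
    have "ln (4 * real Z) = 16 * (b / t)\<^sup>2 * ln (4 * real Z) * ((t / b)\<^sup>2 / 16)"
      using b t by (simp add: field_simps)
    also have "\<dots> \<le> real l * ((t / b)\<^sup>2 / 16)" by (rule mult_right_mono[OF l(1)]) simp
    also have "\<dots> = real l * (t / (2 * b))\<^sup>2 / (4 * 1)" by (simp add: power_divide power_mult_distrib)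
    finally have "exp (- (real l * (t / (2 * b))\<^sup>2 / (4 * 1))) \<le> exp (- ln (4 * real Z))" by simp
    also have "\<dots> = 1 / (4 * real Z)" using Z by (simp add: exp_minus inverse_eq_divide)
    finally have e: "exp (- (real l * (t / (2 * b))\<^sup>2 / (4 * 1))) \<le> 1 / (4 * real Z)" .
    have "(\<Sum>x\<in>Y. 2 * exp (- (real l * (t / (2 * b))\<^sup>2 / (4 * 1))))
        = real (card Y) * (2 * exp (- (real l * (t / (2 * b))\<^sup>2 / (4 * 1))))" by simp
    also have "\<dots> \<le> real Z * (2 * (1 / (4 * real Z)))"
      using Z(1) e by (intro mult_mono) auto
    finally show ?thesis using Z by simp
  qed
  obtain E where E: "E \<in> sets (Pi\<^sub>M {..<l} (\<lambda>_. point_measure J w))"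
    "measure (Pi\<^sub>M {..<l} (\<lambda>_. point_measure J w)) E \<ge> 1 - 1 / 2"
    "\<And>\<tau> x. \<tau> \<in> E \<Longrightarrow> x \<in> Y \<Longrightarrow> \<bar>(\<Sum>i<l. a x (\<tau> i)) / l - (\<integral>i. a x i \<partial>point_measure J w)\<bar> \<le> t / (2 * b)"
  proof (rule simultaneous_sampling[OF prob Y, of a "\<lambda>_. 1" "t / (2 * b)" l "1 / 2"])
    fix x assume x: "x \<in> Y"
    show "a x \<in> borel_measurable (point_measure J w)" by simp
    show "0 \<le> a x i \<and> a x i \<le> 1" if "i \<in> space (point_measure J w)" for i
      using a01[OF x] that by (simp add: space_point_measure)
    have "lincomb N \<phi> c x \<le> b" using abs_lincomb_le[of N \<phi> x c] \<phi>[OF _ x] c by force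
    then show "(\<integral>i. a x i \<partial>point_measure J w) \<le> 1" unfolding mean using b by (simp add: field_simps)
  qed (use b t l small in \<open>auto simp: field_simps\<close>)
  have "E \<noteq> {}" using E(2) by auto
  then obtain \<tau> where \<tau>: "\<tau> \<in> E" by auto
  have "\<tau> \<in> PiE {..<l} (\<lambda>_. J)"
    using \<tau> sets.sets_into_space[OF E(1)] by (auto simp: space_PiM space_point_measure)
  moreover have "\<bar>lincomb N \<phi> c x - b * ((\<Sum>i<l. snd (\<tau> i) * \<phi> (fst (\<tau> i)) x) / real l)\<bar> \<le> t" if x: "x \<in> Y" for x
  proof -
    define S where "S = (\<Sum>i<l. snd (\<tau> i) * \<phi> (fst (\<tau> i)) x) / real l"
    have "(\<Sum>i<l. a x (\<tau> i)) / l = (1 + S) / 2"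
      using l unfolding S_def a_def
      by (simp add: split_beta sum_divide_distrib[symmetric] sum.distrib field_simps)
    with E(3)[OF \<tau> x] have "\<bar>(1 + S) / 2 - (1 + lincomb N \<phi> c x / b) / 2\<bar> \<le> t / (2 * b)"
      unfolding mean by (simp only:)
    also have "(1 + S) / 2 - (1 + lincomb N \<phi> c x / b) / 2 = (b * S - lincomb N \<phi> c x) / (2 * b)"
      using b by (simp add: field_simps)
    finally have "\<bar>b * S - lincomb N \<phi> c x\<bar> \<le> t" using b by (simp add: divide_simps)
    then show ?thesis unfolding S_def by (simp add: abs_minus_commute)
  qed
  ultimately show ?thesis unfolding J_def by blast
qed

text \<open>Refining a net from scale \<open>2 * u\<close> to \<open>u\<close> multiplies its size
  by at most \<open>exp (K0 / u powr p)\<close>. Since \<open>2 powr p \<ge> 2\<close>, the bound at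
  scale \<open>2 * u\<close> has exponent at most \<open>K0 / u powr p\<close>, so the factor 2 in
  \<open>2 * K0\<close> reproduces itself.\<close>

lemma (in bounded_system) card_net_at_scale:
  assumes fin: "finite (space M)" and Z: "card (space M) \<le> Z" "1 \<le> Z"
    and p: "1 \<le> p" "p \<le> 2" and v: "1 \<le> v" and u: "0 < u"
  defines "K0 \<equiv> 4096 * real v * ln (2 * real N) * ln (4 * real Z) / r\<^sup>2"
  shows "\<exists>A\<subseteq>lincomb N \<phi> ` sphere_coeffs v p. finite A \<and> real (card A) \<le> exp (2 * K0 / u powr p) \<and>
        (\<forall>f\<in>lincomb N \<phi> ` sphere_coeffs v p. \<exists>g\<in>A. \<forall>x\<in>space M. \<bar>f x - g x\<bar> \<le> u)"
    (is "?net u")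
proof -
  have K0: "0 \<le> K0" unfolding K0_def using Z N by (intro divide_nonneg_nonneg mult_nonneg_nonneg ln_ge_zero) auto
  have large: "?net u" if u: "0 < u" "2 * radius v p \<le> u" for u
  proof -
    have close: "\<bar>f x - g x\<bar> \<le> u"
      if "f \<in> lincomb N \<phi> ` sphere_coeffs v p" "g \<in> lincomb N \<phi> ` sphere_coeffs v p" "x \<in> space M" for f g x
    proof -
      obtain c d where "f = lincomb N \<phi> c" "c \<in> sphere_coeffs v p" "g = lincomb N \<phi> d" "d \<in> sphere_coeffs v p"
        using \<open>f \<in> _\<close> \<open>g \<in> _\<close> by blast
      then show ?thesis
        using lincomb_le_radius[OF p, of c v x] lincomb_le_radius[OF p, of d v x] \<open>x \<in> _\<close> u by auto
    qed
    have "1 \<le> exp (2 * K0 / u powr p)" using K0 by simp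
    then show ?thesis
    proof (cases "lincomb N \<phi> ` sphere_coeffs v p = {}")
      case False
      then obtain g where "g \<in> lincomb N \<phi> ` sphere_coeffs v p" by blast
      then show ?thesis using close \<open>1 \<le> exp _\<close> by (intro exI[of _ "{g}"]) auto
    qed auto
  qed
  have step: "?net u" if u: "0 < u" "u < 2 * radius v p" and net: "?net (2 * u)" for u
  proof -
    obtain A where A: "A \<subseteq> lincomb N \<phi> ` sphere_coeffs v p" "finite A" "real (card A) \<le> exp (2 * K0 / (2 * u) powr p)"
      "\<forall>f\<in>lincomb N \<phi> ` sphere_coeffs v p. \<exists>g\<in>A. \<forall>x\<in>space M. \<bar>f x - g x\<bar> \<le> 2 * u" using net by blast
    have "\<exists>c'. lincomb N \<phi> c' \<in> A \<and> c' \<in> sphere_coeffs v p \<and> (\<forall>x\<in>space M. \<bar>lincomb N \<phi> c x - lincomb N \<phi> c' x\<bar> \<le> 2 * u)"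
      if "c \<in> sphere_coeffs v p" for c
      using A(1,4) that by blast
    then obtain near where near: "\<And>c. c \<in> sphere_coeffs v p \<Longrightarrow> lincomb N \<phi> (near c) \<in> A \<and> near c \<in> sphere_coeffs v p \<and>
        (\<forall>x\<in>space M. \<bar>lincomb N \<phi> c x - lincomb N \<phi> (near c) x\<bar> \<le> 2 * u)" by metis
    \<comment> \<open>Bounds the coefficient sum of \<open>c - near c\<close>: this difference is
      \<open>2 * v\<close>-sparse, at most \<open>2 * u\<close> in sup norm, with
      \<open>p\<close>-th power integral at most 8, and \<open>2 * 2 * 8 = 32\<close>.\<close>
    define b where "b = sqrt (32 * real v / r\<^sup>2 * u powr (2 - p))"
    have b: "0 < b" unfolding b_def using v r u by simp
    have b2: "b\<^sup>2 = 32 * real v / r\<^sup>2 * u powr (2 - p)" unfolding b_def using r by simp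
    have bu: "(b / u)\<^sup>2 = 32 * (real v / r\<^sup>2) / u powr p"
      using u by (simp add: power_divide b2 powr_diff powr_numeral)
    \<comment> \<open>Below the trivial range \<open>u\<close> is small compared to
      \<open>b\<close>. This makes the tolerance admissible for \<open>maurey\<close> and gives
      \<open>\<Lambda> \<ge> 1\<close>, so rounding up to \<open>l\<close> costs at most a factor
      2.\<close>
    have up: "u powr p \<le> 4 * (real v / r\<^sup>2)"
    proof -
      have "u powr p \<le> (2 * radius v p) powr p" using u p by (intro powr_mono2) auto
      also have "\<dots> = 2 powr p * (real v / r\<^sup>2)"
        using radius_pos[OF v, of p] radius_powr[OF p(1), of v] by (simp add: powr_mult)
      also have "\<dots> \<le> 4 * (real v / r\<^sup>2)" using two_powr_le_four[OF p(2)] by (intro mult_right_mono) auto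
      finally show ?thesis .
    qed
    have bu8: "8 \<le> (b / u)\<^sup>2"
    proof -
      have "8 * u powr p \<le> 32 * (real v / r\<^sup>2)" using up by linarith
      then show ?thesis unfolding bu using u by (subst pos_le_divide_eq) auto
    qed
    then have "1\<^sup>2 \<le> (b / u)\<^sup>2" by simp
    then have "1 \<le> b / u" using b u by (intro power2_le_imp_le[of 1]) auto
    then have ub: "u \<le> b" using u by simp
    have sub: "(\<Sum>j=1..N. \<bar>c j - near c j\<bar>) \<le> b" if c: "c \<in> sphere_coeffs v p" for c
    proof -
      let ?h = "\<lambda>j. c j - near c j"
      note n = near[OF c]
      have "card (coeffs_on N ?h) \<le> 2 * v"
        using card_coeffs_on_diff[of N c "near c"] c n by (auto simp: sphere_coeffs_def)
      then have "(\<Sum>j=1..N. \<bar>?h j\<bar>)\<^sup>2 \<le> real (2 * v) / r\<^sup>2 * ((2 * u) powr (2 - p) * (\<integral>x. \<bar>lincomb N \<phi> ?h x\<bar> powr p \<partial>M))"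
        using n by (intro sum_abs_sq_le[OF p]) (auto simp: lincomb_diff)
      also have "\<dots> \<le> real (2 * v) / r\<^sup>2 * ((2 * u powr (2 - p)) * 8)"
      proof (intro mult_left_mono mult_mono)
        show "(2 * u) powr (2 - p) \<le> 2 * u powr (2 - p)"
          using powr_mono[of "2 - p" 1 "2::real"] p u by (auto simp: powr_mult intro!: mult_right_mono)
        have "(\<integral>x. \<bar>lincomb N \<phi> ?h x\<bar> powr p \<partial>M)
            \<le> (\<integral>x. 4 * (\<bar>lincomb N \<phi> c x\<bar> powr p + \<bar>lincomb N \<phi> (near c) x\<bar> powr p) \<partial>M)"
        proof (intro integral_mono integrable_mult_right Bochner_Integration.integrable_add integrable_powr)
          fix x
          define y z where "y = lincomb N \<phi> c x" and "z = lincomb N \<phi> (near c) x"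
          have "\<bar>y - z\<bar> powr p \<le> (2 * max \<bar>y\<bar> \<bar>z\<bar>) powr p" using p by (intro powr_mono2) auto
          also have "\<dots> = 2 powr p * max \<bar>y\<bar> \<bar>z\<bar> powr p" by (simp add: powr_mult)
          also have "\<dots> \<le> 4 * (\<bar>y\<bar> powr p + \<bar>z\<bar> powr p)"
            using two_powr_le_four[OF p(2)] by (intro mult_mono) (auto simp: max_def)
          finally show "\<bar>lincomb N \<phi> ?h x\<bar> powr p
              \<le> 4 * (\<bar>lincomb N \<phi> c x\<bar> powr p + \<bar>lincomb N \<phi> (near c) x\<bar> powr p)"
            by (simp add: lincomb_diff y_def z_def)
        qed (use p in auto)
        also have "\<dots> = 8" using c n integrable_powr[of p] p by (simp add: sphere_coeffs_def)
        finally show "(\<integral>x. \<bar>lincomb N \<phi> ?h x\<bar> powr p \<partial>M) \<le> 8" .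
      qed (auto intro: integral_nonneg_AE)
      also have "\<dots> = b\<^sup>2" by (simp add: b2)
      finally show ?thesis by (rule power2_le_imp_le) (use b in simp)
    qed
    \<comment> \<open>The tolerance is \<open>u / 2\<close>, because two functions with equal codes
      are compared through a common approximant.\<close>
    define \<Lambda> where "\<Lambda> = 16 * (b / (u / 2))\<^sup>2 * ln (4 * real Z)"
    define l where "l = nat \<lceil>\<Lambda>\<rceil>"
    have "ln (exp 1) \<le> ln (4 * real Z)"
      using Z exp_le by (subst ln_le_cancel_iff) auto
    then have lnZ: "1 \<le> ln (4 * real Z)" by simp
    have \<Lambda>1: "1 \<le> \<Lambda>"
    proof -
      have "1 * 1 \<le> 64 * (b / u)\<^sup>2 * ln (4 * real Z)" using bu8 lnZ by (intro mult_mono) auto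
      then show ?thesis by (simp add: \<Lambda>_def power_divide)
    qed
    have l: "\<Lambda> \<le> real l" "0 < l" "real l \<le> 2 * \<Lambda>" using \<Lambda>1 unfolding l_def by linarith+
    define T where "T = PiE {..<l} (\<lambda>_. {1..N} \<times> {1, -1 :: real})"
    define good where "good c t \<longleftrightarrow> t \<in> T \<and> (\<forall>x\<in>space M. \<bar>lincomb N \<phi> (\<lambda>j. c j - near c j) x
        - b * ((\<Sum>i<l. snd (t i) * \<phi> (fst (t i)) x) / real l)\<bar> \<le> u / 2)" for c t
    have "\<exists>t. good c t" if "c \<in> sphere_coeffs v p" for c
    proof -
      have "\<exists>t\<in>T. \<forall>x\<in>space M. \<bar>lincomb N \<phi> (\<lambda>j. c j - near c j) x
          - b * ((\<Sum>i<l. snd (t i) * \<phi> (fst (t i)) x) / real l)\<bar> \<le> u / 2"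
        unfolding T_def
        by (rule maurey[OF N fin bound sub[OF that] b _ _ Z]) (use u ub b l in \<open>auto simp: \<Lambda>_def\<close>)
      then show ?thesis unfolding good_def by blast
    qed
    then obtain \<tau> where \<tau>: "\<And>c. c \<in> sphere_coeffs v p \<Longrightarrow> good c (\<tau> c)" by metis
    have finT: "finite T" by (simp add: T_def finite_PiE)
    have cJ: "card ({1..N} \<times> {1, -1 :: real}) = N * 2" by (simp add: card_cartesian_product)
    have "card T = (N * 2) ^ l"
      unfolding T_def card_PiE[OF finite_lessThan] by (simp only: cJ prod_constant card_lessThan)
    then have "real (card T) = (2 * real N) ^ l" by (simp only: of_nat_power of_nat_mult of_nat_numeral mult.commute)
    also have "\<dots> = exp (real l * ln (2 * real N))" using N by (simp add: exp_of_nat_mult)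
    also have "\<dots> \<le> exp (2 * \<Lambda> * ln (2 * real N))"
      using l N by (auto intro!: mult_right_mono ln_ge_zero)
    \<comment> \<open>The origin of the constant in \<open>K0\<close>:
      \<open>2 * 16 * 4 * 32 = 4096\<close>.\<close>
    also have "2 * \<Lambda> * ln (2 * real N) = K0 / u powr p"
    proof -
      have "(b / (u / 2))\<^sup>2 = 4 * (b / u)\<^sup>2" by (simp add: power_divide)
      then show ?thesis unfolding \<Lambda>_def K0_def bu by simp
    qed
    finally have cT: "real (card T) \<le> exp (K0 / u powr p)" .
    have "\<exists>A'\<subseteq>lincomb N \<phi> ` sphere_coeffs v p. finite A' \<and> card A' \<le> card (A \<times> T) \<and>
        (\<forall>f\<in>lincomb N \<phi> ` sphere_coeffs v p. \<exists>g\<in>A'. \<forall>x\<in>space M. \<bar>f x - g x\<bar> \<le> u)"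
    proof (rule net_from_code[where code="\<lambda>c. (lincomb N \<phi> (near c), \<tau> c)"])
      show "finite (A \<times> T)" using A finT by simp
      show "(\<lambda>c. (lincomb N \<phi> (near c), \<tau> c)) ` sphere_coeffs v p \<subseteq> A \<times> T"
        using near \<tau> by (auto simp: good_def)
      fix c c' assume c: "c \<in> sphere_coeffs v p" "c' \<in> sphere_coeffs v p"
        and eq: "(lincomb N \<phi> (near c), \<tau> c) = (lincomb N \<phi> (near c'), \<tau> c')"
      show "\<forall>x\<in>space M. \<bar>lincomb N \<phi> c x - lincomb N \<phi> c' x\<bar> \<le> u"
      proof
        fix x assume x: "x \<in> space M"
        define g where "g = b * ((\<Sum>i<l. snd (\<tau> c i) * \<phi> (fst (\<tau> c i)) x) / real l)"
        define n where "n = lincomb N \<phi> (near c) x"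
        have "\<bar>lincomb N \<phi> c x - n - g\<bar> \<le> u / 2" "\<bar>lincomb N \<phi> c' x - n - g\<bar> \<le> u / 2"
          using \<tau>[OF c(1)] \<tau>[OF c(2)] x eq by (auto simp: good_def g_def n_def lincomb_diff)
        then show "\<bar>lincomb N \<phi> c x - lincomb N \<phi> c' x\<bar> \<le> u" by linarith
      qed
    qed
    then obtain A' where A': "A' \<subseteq> lincomb N \<phi> ` sphere_coeffs v p" "finite A'" "card A' \<le> card (A \<times> T)"
        "\<forall>f\<in>lincomb N \<phi> ` sphere_coeffs v p. \<exists>g\<in>A'. \<forall>x\<in>space M. \<bar>f x - g x\<bar> \<le> u" by blast
    have "real (card A') \<le> real (card A) * real (card T)"
      using A'(3) by (simp add: card_cartesian_product flip: of_nat_mult)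
    also have "\<dots> \<le> exp (2 * K0 / (2 * u) powr p) * exp (K0 / u powr p)"
      using A(3) cT by (intro mult_mono) auto
    also have "\<dots> \<le> exp (2 * K0 / u powr p)"
    proof -
      have "2 * u powr p \<le> (2 * u) powr p"
        using powr_mono[of 1 p "2::real"] p u by (auto simp: powr_mult intro!: mult_right_mono)
      then have "2 * K0 / (2 * u) powr p \<le> 2 * K0 / (2 * u powr p)"
        using K0 u by (intro divide_left_mono) auto
      then show ?thesis by (simp add: exp_add[symmetric])
    qed
    finally show ?thesis using A' by blast
  qed
  \<comment> \<open>The induction counts the doublings that carry \<open>u\<close> into the range
    where one function is already a net.\<close>
  have "?net u" if "0 < u" "2 * radius v p \<le> 2 ^ n * u" for n u
    using that
  proof (induction n arbitrary: u)
    case 0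
    then show ?case by (intro large) auto
  next
    case (Suc n)
    then have "?net (2 * u)" by (intro Suc.IH) (auto simp: algebra_simps)
    then show ?case using large[of u] step[of u] Suc.prems(1) by (cases "u < 2 * radius v p") auto
  qed
  moreover obtain n where "2 * radius v p / u < 2 ^ n" using real_arch_pow[of 2 "2 * radius v p / u"] by auto
  then have "2 * radius v p \<le> 2 ^ n * u" using u by (simp add: field_simps)
  ultimately show ?thesis using u by blast
qed

lemma (in bounded_system) sparse_nets:
  assumes "finite (space M)" "card (space M) \<le> Z" "1 \<le> Z" "1 \<le> p" "p \<le> 2" "1 \<le> v"
  shows "has_nets (lincomb N \<phi> ` sphere_coeffs v p) (space M) p (radius v p)
    (8192 * real v * ln (2 * real N) * ln (4 * real Z) / r\<^sup>2)"
proof -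
  have "8192 * real v * ln (2 * real N) * ln (4 * real Z) / r\<^sup>2
      = 2 * (4096 * real v * ln (2 * real N) * ln (4 * real Z) / r\<^sup>2)" by simp
  then show ?thesis unfolding has_nets_def using card_net_at_scale[OF assms] by (simp only:) blast
qed

section \<open>Reduction to polynomially many points\<close>

definition power_integral :: "'a measure \<Rightarrow> real \<Rightarrow> ('a \<Rightarrow> real) \<Rightarrow> real" where
  "power_integral M p f = (\<integral>x. \<bar>f x\<bar> powr p \<partial>M)"

definition power_mean :: "nat \<Rightarrow> (nat \<Rightarrow> 'a) \<Rightarrow> real \<Rightarrow> ('a \<Rightarrow> real) \<Rightarrow> real" where
  "power_mean m \<xi> p f = (\<Sum>j<m. \<bar>f (\<xi> j)\<bar> powr p) / real m"

lemma power_integral_nonneg: "0 \<le> power_integral M p f"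
  unfolding power_integral_def by (intro integral_nonneg_AE) auto

lemma power_integral_scale: "power_integral M p (\<lambda>x. a * f x) = \<bar>a\<bar> powr p * power_integral M p f"
  by (simp add: power_integral_def abs_mult powr_mult)

lemma power_mean_scale: "power_mean m \<xi> p (\<lambda>x. a * f x) = \<bar>a\<bar> powr p * power_mean m \<xi> p f"
  by (simp add: power_mean_def abs_mult powr_mult sum_distrib_left)

context bounded_system
begin

text \<open>Vanishing holds everywhere, not only almost everywhere: the lower Riesz bound kills all
  coefficients. Sample points may lie in a null set, so this is what functions of zero norm
  require.\<close>

lemma lincomb_eq_0:
  assumes p: "1 \<le> p" and 0: "power_integral M p (lincomb N \<phi> c) = 0"
  shows "lincomb N \<phi> c x = 0"
proof -
  have "AE x in M. \<bar>lincomb N \<phi> c x\<bar> powr p = 0"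
    using 0[unfolded power_integral_def] integrable_powr[of p c] p by (subst (asm) integral_nonneg_eq_0_iff_AE) auto
  then have "AE x in M. (lincomb N \<phi> c x)\<^sup>2 = 0" by eventually_elim auto
  then have "(\<integral>x. (lincomb N \<phi> c x)\<^sup>2 \<partial>M) = (\<integral>x. 0 \<partial>M)" by (intro integral_cong_AE) auto
  then have "r\<^sup>2 * (\<Sum>j=1..N. (c j)\<^sup>2) \<le> 0" using lower[of c] by simp
  then have "(\<Sum>j=1..N. (c j)\<^sup>2) \<le> 0" using r by (simp add: mult_le_0_iff)
  moreover have "0 \<le> (\<Sum>j=1..N. (c j)\<^sup>2)" by (intro sum_nonneg) auto
  ultimately have "(\<Sum>j=1..N. (c j)\<^sup>2) = 0" by linarith
  then have "\<forall>j\<in>{1..N}. c j = 0" by (subst (asm) sum_nonneg_eq_0_iff) auto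
  then show ?thesis by (simp add: lincomb_def)
qed

text \<open>Both sides are homogeneous of degree \<open>p\<close> and scaling preserves the support,
  so the unit sphere suffices; zero norm is covered by \<open>lincomb_eq_0\<close>.\<close>

lemma discretize:
  assumes p: "1 \<le> p" "p \<le> 2" and w: "1 \<le> w"
    and nets: "has_nets (lincomb N \<phi> ` sphere_coeffs w p) (space M) p (radius w p) K" "0 \<le> K"
    and \<epsilon>: "0 < \<epsilon>" "\<epsilon> \<le> 1" and n: "1 \<le> n" "radius w p \<le> 2 ^ n * (\<epsilon> / 16)"
    and m: "150994944 * (real n)\<^sup>2 / \<epsilon> ^ 4 * (K + real n * (real w / r\<^sup>2)) \<le> real m" "0 < m"
  obtains E where "E \<in> sets (Pi\<^sub>M {..<m} (\<lambda>_. M))" "measure (Pi\<^sub>M {..<m} (\<lambda>_. M)) E \<ge> 3 / 4"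
    "\<And>\<xi> c. \<xi> \<in> E \<Longrightarrow> card (coeffs_on N c) \<le> w \<Longrightarrow>
      \<bar>power_mean m \<xi> p (lincomb N \<phi> c) - power_integral M p (lincomb N \<phi> c)\<bar>
        \<le> \<epsilon> * power_integral M p (lincomb N \<phi> c)"
proof -
  define F where "F = lincomb N \<phi> ` sphere_coeffs w p"
  obtain E where E: "E \<in> sets (Pi\<^sub>M {..<m} (\<lambda>_. M))" "measure (Pi\<^sub>M {..<m} (\<lambda>_. M)) E \<ge> 3 / 4"
    "\<And>\<xi> f. \<xi> \<in> E \<Longrightarrow> f \<in> F \<Longrightarrow> \<bar>power_mean m \<xi> p f - 1\<bar> \<le> \<epsilon>"
    unfolding power_mean_def
  proof (rule discretize_unit_sphere[OF prob_space_axioms p, of F "radius w p" K \<epsilon> n m])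
    show "\<bar>f x\<bar> \<le> radius w p" if "f \<in> F" "x \<in> space M" for f x
      using that lincomb_le_radius[OF p] by (auto simp: F_def)
    show "has_nets F (space M) p (radius w p) K" using nets by (simp add: F_def)
    show "150994944 * (real n)\<^sup>2 / \<epsilon> ^ 4 * (K + real n * radius w p powr p) \<le> real m"
      using m(1) by (simp only: radius_powr[OF p(1)])
  qed (use nets \<epsilon> n m in \<open>auto simp: F_def sphere_coeffs_def\<close>)
  show thesis
  proof (rule that[OF E(1,2)])
    fix \<xi> c assume \<xi>: "\<xi> \<in> E" and c: "card (coeffs_on N c) \<le> w"
    define t where "t = power_integral M p (lincomb N \<phi> c)"
    have t0: "0 \<le> t" unfolding t_def by (rule power_integral_nonneg)
    show "\<bar>power_mean m \<xi> p (lincomb N \<phi> c) - power_integral M p (lincomb N \<phi> c)\<bar>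
        \<le> \<epsilon> * power_integral M p (lincomb N \<phi> c)"
    proof (cases "t = 0")
      case True
      then have "lincomb N \<phi> c = (\<lambda>x. 0)" using lincomb_eq_0[OF p(1), of c] by (auto simp: t_def)
      then show ?thesis by (simp add: power_mean_def power_integral_def)
    next
      case False
      then have t: "0 < t" using t0 by simp
      define a where "a = t powr (- 1 / p)"
      have "a powr p = t powr (- 1)" unfolding a_def powr_powr using p by simp
      then have a: "0 < a" "a powr p = 1 / t"
        using t by (simp_all add: a_def powr_minus inverse_eq_divide)
      have scale: "lincomb N \<phi> (\<lambda>j. a * c j) = (\<lambda>x. a * lincomb N \<phi> c x)"
        by (simp add: lincomb_scale fun_eq_iff)
      have a': "\<bar>a\<bar> powr p = 1 / t" using a by simp
      have "coeffs_on N (\<lambda>j. a * c j) = coeffs_on N c" using a by (simp add: coeffs_on_def)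
      moreover have "power_integral M p (lincomb N \<phi> (\<lambda>j. a * c j)) = 1"
      proof -
        have "power_integral M p (lincomb N \<phi> (\<lambda>j. a * c j)) = \<bar>a\<bar> powr p * power_integral M p (lincomb N \<phi> c)"
          by (subst scale) (rule power_integral_scale)
        also have "\<dots> = 1 / t * t" by (rule arg_cong2[OF a' t_def[symmetric]])
        also have "\<dots> = 1" using t by simp
        finally show ?thesis .
      qed
      ultimately have "lincomb N \<phi> (\<lambda>j. a * c j) \<in> F"
        unfolding F_def using c by (intro imageI) (simp add: sphere_coeffs_def power_integral_def)
      from E(3)[OF \<xi> this] have "\<bar>1 / t * power_mean m \<xi> p (lincomb N \<phi> c) - 1\<bar> \<le> \<epsilon>"
        by (subst (asm) scale) (subst (asm) power_mean_scale, simp only: a')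
      also have "1 / t * power_mean m \<xi> p (lincomb N \<phi> c) - 1 = (power_mean m \<xi> p (lincomb N \<phi> c) - t) / t"
        using t by (simp add: field_simps)
      finally show ?thesis using t unfolding t_def[symmetric] by (simp add: abs_divide divide_le_eq)
    qed
  qed
qed

lemma radius_le: "1 \<le> w \<Longrightarrow> 1 \<le> p \<Longrightarrow> radius w p \<le> real w / r\<^sup>2"
proof -
  assume w: "1 \<le> w" and p: "1 \<le> p"
  have "1 * r\<^sup>2 \<le> real w * 1" using w r by (intro mult_mono) (auto simp: power_le_one)
  then have "1 \<le> real w / r\<^sup>2" using r by (simp add: field_simps)
  then have "radius w p \<le> (real w / r\<^sup>2) powr 1" unfolding radius_def using p by (intro powr_mono) auto
  then show ?thesis using \<open>1 \<le> real w / r\<^sup>2\<close> by simp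
qed

end

lemma dyadic_between:
  fixes x :: real
  assumes "1 < x"
  obtains n where "1 \<le> n" "x \<le> 2 ^ n" "2 ^ n \<le> 2 * x"
proof -
  define n where "n = (LEAST n. x \<le> 2 ^ n)"
  have ex: "\<exists>n. x \<le> 2 ^ n" using real_arch_pow[of 2 x] by (auto intro: less_imp_le)
  have n: "x \<le> 2 ^ n" unfolding n_def by (rule LeastI_ex[OF ex])
  have n1: "1 \<le> n" using n assms by (cases n) auto
  then have "\<not> x \<le> 2 ^ (n - 1)" using not_less_Least[of "n - 1" "\<lambda>n. x \<le> 2 ^ n"] by (simp add: n_def)
  then have "2 ^ n \<le> 2 * x" using n1 by (cases n) auto
  with n n1 show ?thesis using that[of n] by blast
qed

lemma of_nat_le_two_power: "real n \<le> 2 ^ n"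
  using of_nat_less_two_power[of n, where ?'a = real] by simp

text \<open>The Riesz bound and all \<open>p\<close>-norms survive the passage to polynomially many points, so that
  sup norms over the sample cost only a factor of order \<open>ln (N / \<epsilon>)\<close> in the entropy.\<close>
lemma (in bounded_system) polynomial_discretization:
  assumes p: "1 \<le> p" "p \<le> 2" and \<epsilon>: "0 < \<epsilon>" "\<epsilon> \<le> 1"
  obtains m \<xi> where "1 \<le> m" "4 * real m \<le> 603168768 * 150994944 / r ^ 8 * (real N / \<epsilon>) ^ 7"
    "\<And>j. j < m \<Longrightarrow> \<xi> j \<in> space M"
    "\<And>c. \<bar>power_mean m \<xi> p (lincomb N \<phi> c) - power_integral M p (lincomb N \<phi> c)\<bar>
        \<le> \<epsilon> / 3 * power_integral M p (lincomb N \<phi> c)"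
    "\<And>c. r\<^sup>2 / 2 * (\<Sum>j=1..N. (c j)\<^sup>2) \<le> (\<Sum>j<m. (lincomb N \<phi> c (\<xi> j))\<^sup>2) / m"
proof -
  \<comment> \<open>Chosen so that \<open>2 ^ n \<ge> x\<close> lets the slices of a run at
    precision \<open>\<epsilon> / 3\<close> reach the sup norm bound:
    \<open>3 * 16 = 48\<close>.\<close>
  define x where "x = 48 * real N / (r\<^sup>2 * \<epsilon>)"
  have r2: "0 < r\<^sup>2" "r\<^sup>2 \<le> 1" using r by (auto simp: power_le_one)
  have re: "0 < r\<^sup>2 * \<epsilon>" "r\<^sup>2 * \<epsilon> \<le> 1" using r2 \<epsilon> by (auto simp: mult_le_one)
  have "48 * 1 \<le> 48 * real N" using N by simp
  also have "\<dots> \<le> x" unfolding x_def using re by (simp add: le_divide_eq mult_left_le)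
  finally have x: "48 \<le> x" by simp
  then obtain n where n: "1 \<le> n" "x \<le> 2 ^ n" "2 ^ n \<le> 2 * x" using dyadic_between[of x] by auto
  \<comment> \<open>A logarithm is bounded by its argument, since a polynomial number of points is
    all that is wanted.\<close>
  have nx: "real n \<le> 2 * x" using of_nat_le_two_power[of n] n(3) by linarith
  \<comment> \<open>The factor \<open>81 = 3 ^ 4\<close> stems from the precision
    \<open>\<epsilon> / 3\<close>. The same size also covers the run for the exponent 2 at precision
    1/2.\<close>
  define X where "X = 81 * 150994944 * (real n)\<^sup>2 / \<epsilon> ^ 4 * (5 * real N ^ 3 / r\<^sup>2 + real n * (real N / r\<^sup>2))"
  define m where "m = nat \<lceil>X\<rceil>"
  have X0: "0 \<le> X" unfolding X_def using \<epsilon> by simp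
  have "X > 0" unfolding X_def using \<epsilon> n N r2 by (intro mult_pos_pos divide_pos_pos add_pos_nonneg) auto
  then have m: "X \<le> real m" "0 < m" "real m \<le> X + 1" unfolding m_def by linarith+
  have "real N / r\<^sup>2 = x * (\<epsilon> / 48)" unfolding x_def using \<epsilon> r2 by (simp add: field_simps)
  also have "\<dots> \<le> 2 ^ n * (\<epsilon> / 48)" using n \<epsilon> by (intro mult_right_mono) auto
  finally have nr: "real N / r\<^sup>2 \<le> 2 ^ n * (\<epsilon> / 48)" .
  have K: "0 \<le> 5 * real N ^ 3 / r\<^sup>2" by simp
  obtain E1 where E1: "E1 \<in> sets (Pi\<^sub>M {..<m} (\<lambda>_. M))" "measure (Pi\<^sub>M {..<m} (\<lambda>_. M)) E1 \<ge> 3 / 4"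
    "\<And>\<xi> c. \<xi> \<in> E1 \<Longrightarrow> card (coeffs_on N c) \<le> N \<Longrightarrow>
      \<bar>power_mean m \<xi> p (lincomb N \<phi> c) - power_integral M p (lincomb N \<phi> c)\<bar>
        \<le> \<epsilon> / 3 * power_integral M p (lincomb N \<phi> c)"
  proof (rule discretize[OF p N crude_nets[OF p] K, of "\<epsilon> / 3" n m])
    show "radius N p \<le> 2 ^ n * (\<epsilon> / 3 / 16)" using radius_le[OF N p(1)] nr by linarith
    show "150994944 * (real n)\<^sup>2 / (\<epsilon> / 3) ^ 4 * (5 * real N ^ 3 / r\<^sup>2 + real n * (real N / r\<^sup>2)) \<le> real m"
      using m(1) by (simp add: X_def power_divide)
  qed (use \<epsilon> n m in auto)
  obtain E2 where E2: "E2 \<in> sets (Pi\<^sub>M {..<m} (\<lambda>_. M))" "measure (Pi\<^sub>M {..<m} (\<lambda>_. M)) E2 \<ge> 3 / 4"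
    "\<And>\<xi> c. \<xi> \<in> E2 \<Longrightarrow> card (coeffs_on N c) \<le> N \<Longrightarrow>
      \<bar>power_mean m \<xi> 2 (lincomb N \<phi> c) - power_integral M 2 (lincomb N \<phi> c)\<bar>
        \<le> 1 / 2 * power_integral M 2 (lincomb N \<phi> c)"
  proof (rule discretize[OF _ _ N crude_nets K, of 2 "1 / 2" n m])
    have "2 ^ n * (\<epsilon> / 48) \<le> 2 ^ n * (1 / 2 / 16 :: real)" using \<epsilon> by (intro mult_left_mono) auto
    then show "radius N 2 \<le> 2 ^ n * (1 / 2 / 16)" using radius_le[OF N, of 2] nr by linarith
    have "150994944 * (real n)\<^sup>2 / (1 / 2) ^ 4 \<le> 81 * 150994944 * (real n)\<^sup>2 / \<epsilon> ^ 4"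
    proof -
      have "150994944 * (real n)\<^sup>2 / (1 / 2) ^ 4 \<le> 81 * 150994944 * (real n)\<^sup>2 / 1"
        by (simp add: power_divide)
      also have "\<dots> \<le> 81 * 150994944 * (real n)\<^sup>2 / \<epsilon> ^ 4"
        using \<epsilon> by (intro divide_left_mono) (auto simp: power_le_one)
      finally show ?thesis .
    qed
    then have "150994944 * (real n)\<^sup>2 / (1 / 2) ^ 4 * (5 * real N ^ 3 / r\<^sup>2 + real n * (real N / r\<^sup>2)) \<le> X"
      unfolding X_def by (intro mult_right_mono) auto
    then show "150994944 * (real n)\<^sup>2 / (1 / 2) ^ 4 * (5 * real N ^ 3 / r\<^sup>2 + real n * (real N / r\<^sup>2)) \<le> real m"
      using m(1) by linarith
  qed (use n m in auto)
  interpret P: product_prob_space "\<lambda>_. M" "{..<m}" ..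
  \<comment> \<open>Two events of probability at least 3/4 meet, so one sample preserves both the
    \<open>p\<close>-norms and the lower Riesz bound.\<close>
  have "E1 \<inter> E2 \<noteq> {}"
  proof
    assume "E1 \<inter> E2 = {}"
    then have "measure (Pi\<^sub>M {..<m} (\<lambda>_. M)) (E1 \<union> E2)
        = measure (Pi\<^sub>M {..<m} (\<lambda>_. M)) E1 + measure (Pi\<^sub>M {..<m} (\<lambda>_. M)) E2"
      using E1 E2 by (intro finite_measure.finite_measure_Union[OF prob_space.finite_measure[OF P.prob_space_axioms]]) auto
    then show False using E1(2) E2(2) prob_space.prob_le_1[OF P.prob_space_axioms, of "E1 \<union> E2"] by linarith
  qed
  then obtain \<xi> where \<xi>: "\<xi> \<in> E1" "\<xi> \<in> E2" by auto
  have full: "card (coeffs_on N c) \<le> N" for c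
  proof -
    have "coeffs_on N c \<subseteq> {1..N}" by (auto simp: coeffs_on_def)
    from card_mono[OF _ this] show ?thesis by simp
  qed
  show thesis
  proof (rule that[of m \<xi>])
    show "1 \<le> m" using m by simp
    have "X \<le> 81 * 150994944 * (2 * x)\<^sup>2 / \<epsilon> ^ 4 * (101 * real N ^ 3 / (r ^ 4 * \<epsilon>))"
      unfolding X_def
    proof (intro mult_mono divide_right_mono)
      show "(real n)\<^sup>2 \<le> (2 * x)\<^sup>2" using nx by (intro power_mono) auto
      have "5 * real N ^ 3 / r\<^sup>2 \<le> 5 * real N ^ 3 / (r ^ 4 * \<epsilon>)"
      proof (intro divide_left_mono)
        have "r ^ 4 * \<epsilon> = r\<^sup>2 * (r\<^sup>2 * \<epsilon>)" by (simp add: power2_eq_square power4_eq_xxxx)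
        also have "\<dots> \<le> r\<^sup>2 * 1" using re by (intro mult_left_mono) auto
        finally show "r ^ 4 * \<epsilon> \<le> r\<^sup>2" by simp
      qed (use r \<epsilon> in auto)
      moreover have "real n * (real N / r\<^sup>2) \<le> 96 * real N ^ 3 / (r ^ 4 * \<epsilon>)"
      proof -
        have "real n * (real N / r\<^sup>2) \<le> 2 * x * (real N / r\<^sup>2)" using nx by (intro mult_right_mono) auto
        also have "\<dots> = 96 * real N ^ 2 / (r ^ 4 * \<epsilon>)"
          by (simp add: x_def power2_eq_square power4_eq_xxxx mult_ac)
        also have "\<dots> \<le> 96 * real N ^ 3 / (r ^ 4 * \<epsilon>)"
          using N r \<epsilon> by (intro divide_right_mono mult_left_mono power_increasing) auto
        finally show ?thesis .
      qed
      ultimately have "5 * real N ^ 3 / r\<^sup>2 + real n * (real N / r\<^sup>2)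
          \<le> 5 * real N ^ 3 / (r ^ 4 * \<epsilon>) + 96 * real N ^ 3 / (r ^ 4 * \<epsilon>)" by (rule add_mono)
      also have "\<dots> = 101 * real N ^ 3 / (r ^ 4 * \<epsilon>)" by (simp add: add_divide_distrib[symmetric])
      finally show "5 * real N ^ 3 / r\<^sup>2 + real n * (real N / r\<^sup>2) \<le> 101 * real N ^ 3 / (r ^ 4 * \<epsilon>)" .
    qed (use \<epsilon> r in auto)
    \<comment> \<open>The number is \<open>81 * (2 * 48)\<^sup>2 * 101\<close>. Below it is
      multiplied by 8, a factor 4 for the left side \<open>4 * m\<close> and 2 for rounding up, and
      \<open>N ^ 5\<close> is raised to \<open>N ^ 7\<close> to match the power of
      \<open>\<epsilon>\<close>.\<close>
    also have "\<dots> = 75396096 * 150994944 * (real N ^ 5 / (r ^ 8 * \<epsilon> ^ 7))"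
      using r \<epsilon> by (simp add: x_def field_simps power2_eq_square power4_eq_xxxx power_numeral_reduce)
    also have "\<dots> \<le> 75396096 * 150994944 * (real N ^ 7 / (r ^ 8 * \<epsilon> ^ 7))"
      using N r \<epsilon> by (intro divide_right_mono mult_left_mono power_increasing) auto
    finally have X1: "X \<le> 75396096 * 150994944 * (real N ^ 7 / (r ^ 8 * \<epsilon> ^ 7))" .
    have "r ^ 8 * \<epsilon> ^ 7 \<le> 1 * 1" using r \<epsilon> by (intro mult_mono power_le_one) auto
    also have "\<dots> \<le> real N ^ 7" using N by (simp add: one_le_power)
    finally have "1 \<le> real N ^ 7 / (r ^ 8 * \<epsilon> ^ 7)" using r \<epsilon> by (simp add: field_simps)
    then have "4 * real m \<le> 8 * (75396096 * 150994944 * (real N ^ 7 / (r ^ 8 * \<epsilon> ^ 7)))"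
      using X1 m(3) by linarith
    also have "\<dots> = 603168768 * 150994944 / r ^ 8 * (real N / \<epsilon>) ^ 7" by (simp add: power_divide)
    finally show "4 * real m \<le> 603168768 * 150994944 / r ^ 8 * (real N / \<epsilon>) ^ 7" .
    show "\<xi> j \<in> space M" if "j < m" for j
      using \<xi>(1) sets.sets_into_space[OF E1(1)] that by (fastforce simp: space_PiM PiE_def Pi_def)
    show "\<bar>power_mean m \<xi> p (lincomb N \<phi> c) - power_integral M p (lincomb N \<phi> c)\<bar>
        \<le> \<epsilon> / 3 * power_integral M p (lincomb N \<phi> c)" for c
      by (rule E1(3)[OF \<xi>(1) full])
    have sq: "\<bar>y\<bar> powr 2 = y\<^sup>2" for y :: real by (simp add: powr_numeral)
    show "r\<^sup>2 / 2 * (\<Sum>j=1..N. (c j)\<^sup>2) \<le> (\<Sum>j<m. (lincomb N \<phi> c (\<xi> j))\<^sup>2) / m" for c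
      using E2(3)[OF \<xi>(2) full, of c] lower[of c] unfolding power_mean_def power_integral_def sq abs_le_iff by linarith
  qed
qed

section \<open>The sample size\<close>

text \<open>With \<open>d\<close> the logarithm here, \<open>2 * d\<close> absorbs the additive
  \<open>d\<close> because \<open>ln N / \<epsilon> \<ge> 1 / 2\<close>, and
  \<open>21 = 7 * 3\<close> comes from the seventh power of \<open>N / \<epsilon>\<close>.\<close>

definition points_const :: "real \<Rightarrow> real" where
  "points_const r = 2 * ln (603168768 * 150994944 / r ^ 8) + 21"

text \<open>The outer 2 compensates \<open>ln 2 \<ge> 1 / 2\<close>, the inner 2 absorbs the
  additive constant into \<open>ln (2 * v / \<epsilon>) \<ge> 1 / 2\<close>;
  \<open>192 = 2 * 96\<close> comes from the choice of \<open>n\<close> in the second stage.\<close>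

definition levels_const :: "real \<Rightarrow> real" where
  "levels_const r = 2 * (1 + 2 * ln (192 / r\<^sup>2))"

text \<open>Collects the factors of \<open>sample_size_le\<close>:
  \<open>32768 = 8192 * 2 * 2\<close> from the entropy and \<open>16 = 8 * 2\<close> from the
  slices, a factor 2 in each being due to the halved \<open>r\<^sup>2\<close>.\<close>

definition sample_const :: "real \<Rightarrow> real" where
  "sample_const r = 81 * 150994944 * (levels_const r)\<^sup>2 * (32768 * points_const r + 16 * levels_const r) / r\<^sup>2"

text \<open>Keeps the logarithms of \<open>N\<close> and \<open>2 * v / \<epsilon>\<close> away from
  0, so that additive constants can be absorbed into multiples of them.\<close>

lemma ln_ge_half: "2 \<le> x \<Longrightarrow> 1 / 2 \<le> ln (x :: real)"
proof -
  assume x: "2 \<le> x"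
  have "exp (1 / 2 :: real) \<le> 2" using exp_bound[of "1 / 2 :: real"] by (simp add: power2_eq_square)
  then have "ln (exp (1 / 2 :: real)) \<le> ln x" using x by (subst ln_le_cancel_iff) auto
  then show ?thesis by simp
qed

text \<open>A logarithm of \<open>1 / \<epsilon>\<close> is traded for a full factor
  \<open>1 / \<epsilon>\<close>, the fifth one in the sample size.\<close>

lemma ln_inverse_le:
  fixes \<epsilon> x :: real
  assumes "0 < \<epsilon>" "\<epsilon> \<le> 1" "1 / 2 \<le> y"
  shows "ln (1 / \<epsilon>) \<le> 2 * (y / \<epsilon>)"
proof -
  have "ln (1 / \<epsilon>) \<le> 1 / \<epsilon> - 1" using assms by (intro ln_le_minus_one) auto
  also have "\<dots> \<le> 2 * (1 / 2 / \<epsilon>)" by simp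
  also have "\<dots> \<le> 2 * (y / \<epsilon>)" using assms by (intro mult_left_mono divide_right_mono) auto
  finally show ?thesis .
qed

context
  fixes r \<epsilon> :: real
  assumes r: "0 < r" "r \<le> 1" and \<epsilon>: "0 < \<epsilon>" "\<epsilon> \<le> 1"
begin

lemma points_const_ge: "21 \<le> points_const r"
proof -
  have "r ^ 8 \<le> 1" using r by (simp add: power_le_one)
  then have "1 \<le> 603168768 * 150994944 / r ^ 8" using r by (simp add: field_simps)
  then show ?thesis unfolding points_const_def by simp
qed

lemma levels_const_ge: "2 \<le> levels_const r"
proof -
  have "r\<^sup>2 \<le> 1" using r by (simp add: power_le_one)
  then have "1 \<le> 192 / r\<^sup>2" using r by (simp add: field_simps)
  then show ?thesis unfolding levels_const_def by simp
qed

lemma sample_const_ge: "16 \<le> sample_const r"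
proof -
  have "16 * 1 \<le> (81 * 150994944 * (levels_const r)\<^sup>2 * (32768 * points_const r + 16 * levels_const r)) * (1 / r\<^sup>2)"
  proof (rule mult_mono)
    have "16 \<le> 81 * 150994944 * (2 :: real)\<^sup>2 * (32768 * 21 + 16 * 2)" by simp
    also have "\<dots> \<le> 81 * 150994944 * (levels_const r)\<^sup>2 * (32768 * points_const r + 16 * levels_const r)"
      using points_const_ge levels_const_ge by (intro mult_mono power_mono add_mono) auto
    finally show "16 \<le> 81 * 150994944 * (levels_const r)\<^sup>2 * (32768 * points_const r + 16 * levels_const r)" .
    show "1 \<le> 1 / r\<^sup>2" using r by (simp add: power_le_one)
  qed (use points_const_ge levels_const_ge in auto)
  then show ?thesis by (simp add: sample_const_def)
qed

lemma ln_points_le: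
  assumes x: "1 / 2 \<le> ln (real N)" "1 \<le> N" and m: "1 \<le> m"
    "4 * real m \<le> 603168768 * 150994944 / r ^ 8 * (real N / \<epsilon>) ^ 7"
  shows "ln (4 * real m) \<le> points_const r * (ln (real N) / \<epsilon>)"
proof -
  define d where "d = ln (603168768 * 150994944 / r ^ 8)"
  have d: "0 \<le> d" using points_const_ge by (simp add: d_def points_const_def)
  have y: "1 / 2 \<le> ln (real N) / \<epsilon>" "ln (real N) \<le> ln (real N) / \<epsilon>"
  proof -
    have "ln (real N) * \<epsilon> \<le> ln (real N) * 1" using \<epsilon> x by (intro mult_left_mono) auto
    then show "ln (real N) \<le> ln (real N) / \<epsilon>" using \<epsilon> by (simp add: field_simps)
    with x show "1 / 2 \<le> ln (real N) / \<epsilon>" by linarith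
  qed
  have "ln (4 * real m) \<le> ln (603168768 * 150994944 / r ^ 8 * (real N / \<epsilon>) ^ 7)"
    using m r \<epsilon> x by (subst ln_le_cancel_iff) auto
  also have "\<dots> = d + 7 * ln (real N / \<epsilon>)"
    using r \<epsilon> x unfolding d_def by (subst ln_mult_pos) (auto simp: ln_realpow)
  also have "ln (real N / \<epsilon>) = ln (real N) + ln (1 / \<epsilon>)"
    using \<epsilon> x by (simp add: ln_div)
  also have "d \<le> 2 * d * (ln (real N) / \<epsilon>)"
    using mult_left_mono[OF y(1), of "2 * d"] d by simp
  also have "ln (real N) + ln (1 / \<epsilon>) \<le> 3 * (ln (real N) / \<epsilon>)"
    using y(2) ln_inverse_le[OF \<epsilon> x(1)] by linarith
  finally have "ln (4 * real m) \<le> 2 * d * (ln (real N) / \<epsilon>) + 7 * (3 * (ln (real N) / \<epsilon>))" by simp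
  then show ?thesis by (simp add: points_const_def d_def algebra_simps)
qed

lemma levels_le:
  assumes v: "1 \<le> v" and n: "2 ^ n \<le> 192 * real v / (r\<^sup>2 * \<epsilon>)"
  shows "real n \<le> levels_const r * ln (2 * real v / \<epsilon>)"
proof -
  have "2 * 1 \<le> 2 * real v / \<epsilon>" using v \<epsilon> by (simp add: field_simps)
  then have L: "1 / 2 \<le> ln (2 * real v / \<epsilon>)" by (intro ln_ge_half) simp
  have d: "0 \<le> ln (192 / r\<^sup>2)" using levels_const_ge by (simp add: levels_const_def)
  have "real n * (1 / 2) \<le> real n * ln 2" using ln_ge_half[of 2] by (intro mult_left_mono) auto
  also have "\<dots> = ln (2 ^ n)" by (simp add: ln_realpow)
  also have "\<dots> \<le> ln (192 / r\<^sup>2 * (2 * real v / \<epsilon>))"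
  proof (subst ln_le_cancel_iff)
    have "192 * real v / (r\<^sup>2 * \<epsilon>) \<le> 192 / r\<^sup>2 * (2 * real v / \<epsilon>)"
      using v r \<epsilon> by (simp add: field_simps)
    then show "2 ^ n \<le> 192 / r\<^sup>2 * (2 * real v / \<epsilon>)" using n by linarith
  qed (use v r \<epsilon> in auto)
  also have "\<dots> = ln (192 / r\<^sup>2) + ln (2 * real v / \<epsilon>)" using v r \<epsilon> by (subst ln_mult_pos) auto
  also have "\<dots> \<le> (2 * ln (192 / r\<^sup>2)) * ln (2 * real v / \<epsilon>) + ln (2 * real v / \<epsilon>)"
    using mult_left_mono[OF L, of "2 * ln (192 / r\<^sup>2)"] d by simp
  finally have "2 * (real n * (1 / 2)) \<le> 2 * ((2 * ln (192 / r\<^sup>2)) * ln (2 * real v / \<epsilon>) + ln (2 * real v / \<epsilon>))"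
    by (rule mult_left_mono) simp
  then show ?thesis by (simp add: levels_const_def algebra_simps)
qed

text \<open>The factor \<open>n\<^sup>2\<close> already uses up both permitted logarithms of
  \<open>2 * v / \<epsilon>\<close>. The third \<open>n\<close>, from the slice heights, is paid for
  by this bound instead.\<close>

lemma ln_sparsity_le:
  assumes v: "1 \<le> v" "v \<le> N" and N: "2 \<le> N"
  shows "ln (2 * real v / \<epsilon>) \<le> 8 * (ln (real N))\<^sup>2 / \<epsilon>"
proof -
  have x: "1 / 2 \<le> ln (real N)" using N by (intro ln_ge_half) simp
  have "ln (2 * real v / \<epsilon>) = ln (2 * real v) + ln (1 / \<epsilon>)" using v \<epsilon> by (simp add: ln_div)
  also have "ln (2 * real v) \<le> ln (real N * real N)"
    using v N by (subst ln_le_cancel_iff) (auto intro!: mult_mono)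
  also have "\<dots> = 2 * ln (real N)" using N by (simp add: ln_mult)
  also have "\<dots> \<le> 2 * (ln (real N) / \<epsilon>)"
    using mult_left_mono[OF \<epsilon>(2), of "ln (real N)"] x \<epsilon> by (simp add: field_simps)
  also have "ln (1 / \<epsilon>) \<le> 2 * (ln (real N) / \<epsilon>)" by (rule ln_inverse_le[OF \<epsilon> x])
  finally have "ln (2 * real v / \<epsilon>) \<le> 4 * ln (real N) / \<epsilon>" by simp
  also have "\<dots> \<le> 8 * (ln (real N))\<^sup>2 / \<epsilon>"
    using mult_right_mono[OF x, of "8 * ln (real N)"] x \<epsilon>
    by (intro divide_right_mono) (auto simp: power2_eq_square)
  finally show ?thesis .
qed

lemma sample_size_le:
  assumes v: "1 \<le> v" "v \<le> N" and N: "2 \<le> N" and m: "1 \<le> m"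
    "4 * real m \<le> 603168768 * 150994944 / r ^ 8 * (real N / \<epsilon>) ^ 7"
    and n: "2 ^ n \<le> 192 * real v / (r\<^sup>2 * \<epsilon>)"
  shows "81 * 150994944 * (real n)\<^sup>2 / \<epsilon> ^ 4 *
      (8192 * real v * ln (2 * real N) * ln (4 * real m) / (r\<^sup>2 / 2) + real n * (real v / (r\<^sup>2 / 2)))
    \<le> sample_const r * (real v * (ln (real N))\<^sup>2 * (ln (2 * real v / \<epsilon>))\<^sup>2) / \<epsilon> ^ 5"
    (is "?c * (?K + ?n) \<le> _")
proof -
  let ?L = "ln (2 * real v / \<epsilon>)" and ?l = "ln (real N)" and ?A = "levels_const r" and ?D = "points_const r"
  have x: "1 / 2 \<le> ?l" using N by (intro ln_ge_half) simp
  have A: "0 \<le> ?A" and D: "0 \<le> ?D" using levels_const_ge points_const_ge by auto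
  have L: "0 \<le> ?L" using v \<epsilon> by (intro ln_ge_zero) (simp add: field_simps)
  have nA: "real n \<le> ?A * ?L" by (rule levels_le[OF v(1) n])
  have "ln (2 * real N) \<le> ln (real N * real N)" using N by (subst ln_le_cancel_iff) auto
  also have "\<dots> = 2 * ?l" using N by (simp add: ln_mult)
  finally have l2: "ln (2 * real N) \<le> 2 * ?l" .
  have "ln (2 * real N) * ln (4 * real m) \<le> 2 * ?l * (?D * (?l / \<epsilon>))"
    using l2 ln_points_le[OF x _ m] N m x by (intro mult_mono) auto
  then have "8192 * real v / (r\<^sup>2 / 2) * (ln (2 * real N) * ln (4 * real m))
      \<le> 8192 * real v / (r\<^sup>2 / 2) * (2 * ?l * (?D * (?l / \<epsilon>)))" by (rule mult_left_mono) simp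
  then have K: "?K \<le> 32768 * ?D * (real v * ?l\<^sup>2 / (r\<^sup>2 * \<epsilon>))"
    by (simp add: power2_eq_square algebra_simps)
  have "real n \<le> ?A * (8 * ?l\<^sup>2 / \<epsilon>)"
    using nA mult_left_mono[OF ln_sparsity_le[OF v N] A] by linarith
  then have "real n * (real v / (r\<^sup>2 / 2)) \<le> ?A * (8 * ?l\<^sup>2 / \<epsilon>) * (real v / (r\<^sup>2 / 2))"
    by (rule mult_right_mono) simp
  then have n': "?n \<le> 16 * ?A * (real v * ?l\<^sup>2 / (r\<^sup>2 * \<epsilon>))" by (simp add: algebra_simps)
  have "?c * (?K + ?n) \<le> 81 * 150994944 * (?A * ?L)\<^sup>2 / \<epsilon> ^ 4 *
      (32768 * ?D * (real v * ?l\<^sup>2 / (r\<^sup>2 * \<epsilon>)) + 16 * ?A * (real v * ?l\<^sup>2 / (r\<^sup>2 * \<epsilon>)))"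
  proof (rule mult_mono)
    show "?c \<le> 81 * 150994944 * (?A * ?L)\<^sup>2 / \<epsilon> ^ 4"
      using nA by (intro divide_right_mono mult_left_mono power_mono) (use \<epsilon> in auto)
    show "?K + ?n \<le> 32768 * ?D * (real v * ?l\<^sup>2 / (r\<^sup>2 * \<epsilon>)) + 16 * ?A * (real v * ?l\<^sup>2 / (r\<^sup>2 * \<epsilon>))"
      by (rule add_mono[OF K n'])
    have "0 \<le> ?K" using N m by (intro divide_nonneg_nonneg mult_nonneg_nonneg ln_ge_zero) auto
    then show "0 \<le> ?K + ?n" by (rule add_nonneg_nonneg) simp
  qed (use \<epsilon> in simp)
  also have "\<dots> = sample_const r * (real v * ?l\<^sup>2 * ?L\<^sup>2) / \<epsilon> ^ 5"
    using r \<epsilon> by (simp add: sample_const_def field_simps power2_eq_square eval_nat_numeral)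
  finally show ?thesis .
qed

end

text \<open>Two rounds of sampling, the second one from the indices of the first sample, where the
  entropy bound for finite spaces is available.\<close>

lemma (in bounded_system) sparse_discretization:
  assumes p: "1 \<le> p" "p \<le> 2" and \<epsilon>: "0 < \<epsilon>" "\<epsilon> \<le> 1" and N2: "2 \<le> N" and v: "1 \<le> v" "v \<le> N"
  obtains m \<xi> where "1 \<le> m"
    "real m \<le> 2 * (sample_const r * (real v * (ln (real N))\<^sup>2 * (ln (2 * real v / \<epsilon>))\<^sup>2) / \<epsilon> ^ 5)"
    "\<And>j. j < m \<Longrightarrow> \<xi> j \<in> space M"
    "\<And>c. card (coeffs_on N c) \<le> v \<Longrightarrow>
      \<bar>power_mean m \<xi> p (lincomb N \<phi> c) - power_integral M p (lincomb N \<phi> c)\<bar>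
        \<le> \<epsilon> * power_integral M p (lincomb N \<phi> c)"
proof -
  obtain m1 \<xi> where m1: "1 \<le> m1" "4 * real m1 \<le> 603168768 * 150994944 / r ^ 8 * (real N / \<epsilon>) ^ 7"
    and \<xi>: "\<And>j. j < m1 \<Longrightarrow> \<xi> j \<in> space M"
    and approx1: "\<And>c. \<bar>power_mean m1 \<xi> p (lincomb N \<phi> c) - power_integral M p (lincomb N \<phi> c)\<bar>
        \<le> \<epsilon> / 3 * power_integral M p (lincomb N \<phi> c)"
    and riesz: "\<And>c. r\<^sup>2 / 2 * (\<Sum>j=1..N. (c j)\<^sup>2) \<le> (\<Sum>j<m1. (lincomb N \<phi> c (\<xi> j))\<^sup>2) / m1"
    using polynomial_discretization[OF p \<epsilon>] by blast
  \<comment> \<open>The measure lives on indices and not on points, so repeated points keep their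
    multiplicity.\<close>
  define U where "U = uniform_count_measure {..<m1}"
  define \<psi> where "\<psi> j i = \<phi> j (\<xi> i)" for j i
  have spU: "space U = {..<m1}" by (simp add: U_def space_uniform_count_measure)
  have setsU: "sets U = Pow {..<m1}" by (simp add: U_def sets_uniform_count_measure)
  have intU: "(\<integral>i. g i \<partial>U) = (\<Sum>i<m1. g i) / m1" for g :: "nat \<Rightarrow> real"
    by (simp add: U_def integral_uniform_count_measure)
  have lin: "lincomb N \<psi> c i = lincomb N \<phi> c (\<xi> i)" for c i by (simp add: lincomb_def \<psi>_def)
  have r2: "(r / sqrt 2)\<^sup>2 = r\<^sup>2 / 2" by (simp add: power_divide)
  \<comment> \<open>Sampling the squared norm to relative precision 1/2 has halved the lower Riesz
    bound, hence \<open>r / sqrt 2\<close>.\<close>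
  interpret Q: bounded_system U \<psi> N "r / sqrt 2"
  proof (rule bounded_system.intro)
    show "prob_space U" unfolding U_def using m1 by (intro prob_space_uniform_count_measure) (auto simp: lessThan_empty_iff)
    show "bounded_system_axioms U \<psi> N (r / sqrt 2)"
    proof
      show "\<psi> j \<in> borel_measurable U" for j by (rule measurableI) (auto simp: setsU spU)
      show "\<bar>\<psi> j i\<bar> \<le> 1" if "j \<in> {1..N}" "i \<in> space U" for j i
        using bound[OF that(1) \<xi>] that by (simp add: \<psi>_def spU)
      have "r \<le> 1 * sqrt 2" using r real_sqrt_ge_one[of 2] by linarith
      then show "r / sqrt 2 \<le> 1" by (subst divide_le_eq) auto
      show "(r / sqrt 2)\<^sup>2 * (\<Sum>j=1..N. (c j)\<^sup>2) \<le> (\<integral>i. (lincomb N \<psi> c i)\<^sup>2 \<partial>U)" for c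
        unfolding r2 intU lin by (rule riesz)
    qed (use N r in auto)
  qed
  define x where "x = 96 * real v / (r\<^sup>2 * \<epsilon>)"
  have re: "0 < r\<^sup>2 * \<epsilon>" "r\<^sup>2 * \<epsilon> \<le> 1" using r \<epsilon> by (auto intro!: mult_le_one simp: power_le_one)
  have "96 * 1 \<le> 96 * real v" using v by simp
  also have "\<dots> \<le> x" unfolding x_def using re by (simp add: le_divide_eq mult_left_le)
  finally have "1 < x" by simp
  then obtain n where n: "1 \<le> n" "x \<le> 2 ^ n" "2 ^ n \<le> 2 * x" using dyadic_between by blast
  have rad: "Q.radius v p \<le> 2 ^ n * (\<epsilon> / 3 / 16)"
  proof -
    have "Q.radius v p \<le> real v / (r\<^sup>2 / 2)" using Q.radius_le[OF v(1) p(1)] unfolding r2 .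
    also have "\<dots> = x * (\<epsilon> / 3 / 16)" using r \<epsilon> by (simp add: x_def field_simps)
    also have "\<dots> \<le> 2 ^ n * (\<epsilon> / 3 / 16)" using n \<epsilon> by (intro mult_right_mono) auto
    finally show ?thesis .
  qed
  define K where "K = 8192 * real v * ln (2 * real N) * ln (4 * real m1) / (r\<^sup>2 / 2)"
  have K: "0 \<le> K" unfolding K_def using N m1 by (intro divide_nonneg_nonneg mult_nonneg_nonneg ln_ge_zero) auto
  have nets: "has_nets (lincomb N \<psi> ` Q.sphere_coeffs v p) (space U) p (Q.radius v p) K"
    unfolding K_def r2[symmetric] using m1 p v by (intro Q.sparse_nets) (auto simp: spU)
  define Y where "Y = sample_const r * (real v * (ln (real N))\<^sup>2 * (ln (2 * real v / \<epsilon>))\<^sup>2) / \<epsilon> ^ 5"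
  define m where "m = nat \<lceil>Y\<rceil>"
  \<comment> \<open>Ensures that rounding up at most doubles \<open>Y\<close>. Both squared
    logarithms are at least 1/4, which is matched by \<open>sample_const r \<ge> 16\<close>.\<close>
  have Y1: "1 \<le> Y"
  proof -
    have l: "1 / 2 \<le> ln (real N)" using N2 by (intro ln_ge_half) simp
    have L: "1 / 2 \<le> ln (2 * real v / \<epsilon>)" using v \<epsilon> by (intro ln_ge_half) (simp add: field_simps)
    have "1 = 16 * (1 * (1 / 2)\<^sup>2 * (1 / 2)\<^sup>2) / (1 :: real)" by (simp add: power2_eq_square)
    also have "\<dots> \<le> Y" unfolding Y_def
      using sample_const_ge[OF r \<epsilon>] v \<epsilon> l L
      by (intro frac_le mult_mono power_mono mult_nonneg_nonneg) (auto simp: power_le_one)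
    finally show ?thesis .
  qed
  then have m: "Y \<le> real m" "0 < m" "real m \<le> 2 * Y" unfolding m_def by linarith+
  have "81 * 150994944 * (real n)\<^sup>2 / \<epsilon> ^ 4 * (K + real n * (real v / (r\<^sup>2 / 2))) \<le> Y"
    unfolding K_def Y_def using n(3) by (intro sample_size_le[OF r \<epsilon> v N2 m1]) (simp add: x_def)
  then have big: "150994944 * (real n)\<^sup>2 / (\<epsilon> / 3) ^ 4 * (K + real n * (real v / (r / sqrt 2)\<^sup>2)) \<le> real m"
    unfolding r2 using m(1) by (simp add: power_divide)
  obtain E where E: "E \<in> sets (Pi\<^sub>M {..<m} (\<lambda>_. U))" "measure (Pi\<^sub>M {..<m} (\<lambda>_. U)) E \<ge> 3 / 4"
    "\<And>\<tau> c. \<tau> \<in> E \<Longrightarrow> card (coeffs_on N c) \<le> v \<Longrightarrow>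
      \<bar>power_mean m \<tau> p (lincomb N \<psi> c) - power_integral U p (lincomb N \<psi> c)\<bar>
        \<le> \<epsilon> / 3 * power_integral U p (lincomb N \<psi> c)"
    using Q.discretize[OF p v(1) nets K _ _ n(1) rad big m(2)] \<epsilon> by auto
  have "E \<noteq> {}" using E(2) by auto
  then obtain \<tau> where \<tau>: "\<tau> \<in> E" by auto
  have \<tau>m: "\<tau> j < m1" if "j < m" for j
    using \<tau> sets.sets_into_space[OF E(1)] that by (fastforce simp: space_PiM PiE_def Pi_def spU)
  show thesis
  proof (rule that[of m "\<lambda>j. \<xi> (\<tau> j)"])
    show "1 \<le> m" using m by simp
    show "real m \<le> 2 * (sample_const r * (real v * (ln (real N))\<^sup>2 * (ln (2 * real v / \<epsilon>))\<^sup>2) / \<epsilon> ^ 5)"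
      using m(3) by (simp add: Y_def)
    show "\<xi> (\<tau> j) \<in> space M" if "j < m" for j by (rule \<xi>[OF \<tau>m[OF that]])
    fix c assume c: "card (coeffs_on N c) \<le> v"
    define I where "I = power_integral M p (lincomb N \<phi> c)"
    define J where "J = power_mean m1 \<xi> p (lincomb N \<phi> c)"
    define S where "S = power_mean m (\<lambda>j. \<xi> (\<tau> j)) p (lincomb N \<phi> c)"
    have I: "0 \<le> I" unfolding I_def by (rule power_integral_nonneg)
    have IJ: "\<bar>J - I\<bar> \<le> \<epsilon> / 3 * I" unfolding I_def J_def by (rule approx1)
    have "power_integral U p (lincomb N \<psi> c) = J"
      by (simp add: power_integral_def J_def power_mean_def intU lin)
    moreover have "power_mean m \<tau> p (lincomb N \<psi> c) = S"
      by (simp add: S_def power_mean_def lin)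
    ultimately have SJ: "\<bar>S - J\<bar> \<le> \<epsilon> / 3 * J" using E(3)[OF \<tau> c] by simp
    \<comment> \<open>The second error is relative to \<open>J\<close>, which is at most
      \<open>2 * I\<close>, so the two rounds add up to exactly
      \<open>\<epsilon> * I\<close>.\<close>
    have "\<epsilon> / 3 * I \<le> 1 * I" using I \<epsilon> by (intro mult_right_mono) auto
    then have "J \<le> 2 * I" using IJ unfolding abs_le_iff by linarith
    then have "\<epsilon> / 3 * J \<le> \<epsilon> / 3 * (2 * I)" using \<epsilon> by (intro mult_left_mono) auto
    then have "\<bar>S - I\<bar> \<le> \<epsilon> / 3 * (2 * I) + \<epsilon> / 3 * I"
      using SJ IJ unfolding abs_le_iff by linarith
    then show "\<bar>power_mean m (\<lambda>j. \<xi> (\<tau> j)) p (lincomb N \<phi> c) - power_integral M p (lincomb N \<phi> c)\<bar>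
        \<le> \<epsilon> * power_integral M p (lincomb N \<phi> c)"
      unfolding S_def[symmetric] I_def[symmetric] by (simp add: mult.commute)
  qed
qed

section \<open>Null sets and transfer between spaces\<close>

lemma Lp_norm_powr: "0 < p \<Longrightarrow> Lp_norm M p f powr p = power_integral M p f"
  using power_integral_nonneg[of M p f] by (simp add: Lp_norm_def power_integral_def powr_powr)

lemma sparse_sums_lincomb:
  assumes "f \<in> sparse_sums v N \<phi>"
  obtains c where "f = lincomb N \<phi> c" "card (coeffs_on N c) \<le> v"
proof -
  obtain G c where G: "G \<subseteq> {1..N}" "card G = v" and f: "f = (\<lambda>x. \<Sum>i\<in>G. c i * \<phi> i x)"
    using assms by (auto simp: sparse_sums_def)
  define d where "d j = (if j \<in> G then c j else 0)" for j
  have fin: "finite G" using G finite_subset by blast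
  have "f = lincomb N \<phi> d"
    unfolding f lincomb_def d_def using G(1)
    by (intro ext sum.mono_neutral_cong_left) auto
  moreover have "card (coeffs_on N d) \<le> v"
    unfolding G(2)[symmetric] using fin by (intro card_mono) (auto simp: coeffs_on_def d_def)
  ultimately show ?thesis by (rule that)
qed

lemma bounded_Riesz_basis_bound:
  assumes M: "prob_space M" and B: "bounded_Riesz_basis M N \<phi> R1 R2"
  shows "AE x in M. \<forall>j\<in>{1..N}. \<bar>\<phi> j x\<bar> \<le> 1"
proof -
  have "AE x in M. \<bar>\<phi> j x\<bar> \<le> 1" if "j \<in> {1..N}" for j
  proof -
    have "esssup M (\<lambda>x. ereal \<bar>\<phi> j x\<bar>) \<le> 1"
      using B that by (simp add: bounded_Riesz_basis_def Linf_norm_def)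
    moreover have "AE x in M. ereal \<bar>\<phi> j x\<bar> \<le> esssup M (\<lambda>x. ereal \<bar>\<phi> j x\<bar>)"
      by (rule esssup_AE)
    ultimately show ?thesis
      by (auto elim!: eventually_mono dest: order_trans simp: one_ereal_def)
  qed
  then show ?thesis by (subst AE_ball_countable) auto
qed

text \<open>The sup norm bound holds only almost everywhere, so a null set is removed from the space.\<close>
lemma bounded_system_restrict:
  assumes M: "prob_space M" and B: "bounded_Riesz_basis M N \<phi> R1 R2" and R1: "0 < R1" and N: "1 \<le> N"
  obtains S where "S \<in> sets M" "bounded_system (restrict_space M S) \<phi> N (min R1 1)"
    "\<And>p c. power_integral (restrict_space M S) p (lincomb N \<phi> c) = power_integral M p (lincomb N \<phi> c)"
proof -
  interpret prob_space M by fact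
  have meas [measurable]: "\<phi> j \<in> borel_measurable M" if "j \<in> {1..N}" for j
    using B that by (auto simp: bounded_Riesz_basis_def)
  have lin [measurable]: "lincomb N \<phi> c \<in> borel_measurable M" for c
    unfolding lincomb_def[abs_def] by measurable
  define S where "S = {x \<in> space M. \<forall>j\<in>{1..N}. \<bar>\<phi> j x\<bar> \<le> 1}"
  have S: "S \<in> sets M" unfolding S_def by measurable
  have AES: "AE x in M. x \<in> S"
    using bounded_Riesz_basis_bound[OF M B] AE_space by eventually_elim (auto simp: S_def)
  have restr: "(\<integral>x. g x \<partial>restrict_space M S) = (\<integral>x. g x \<partial>M)"
    if [measurable]: "g \<in> borel_measurable M" for g :: "_ \<Rightarrow> real"
  proof -
    have [measurable]: "S \<in> sets M" by (rule S)
    have "(\<integral>x. g x \<partial>restrict_space M S) = (\<integral>x. indicator S x *\<^sub>R g x \<partial>M)"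
      using S by (intro integral_restrict_space) auto
    also have "\<dots> = (\<integral>x. g x \<partial>M)"
      using AES by (intro integral_cong_AE) (auto elim!: eventually_mono)
    finally show ?thesis .
  qed
  have "bounded_system (restrict_space M S) \<phi> N (min R1 1)"
  proof (rule bounded_system.intro)
    show "prob_space (restrict_space M S)"
      using S AES by (intro prob_space_restrict_space) (auto simp: emeasure_eq_1_AE)
    show "bounded_system_axioms (restrict_space M S) \<phi> N (min R1 1)"
    proof
      show "\<phi> j \<in> borel_measurable (restrict_space M S)" if "j \<in> {1..N}" for j
        using meas[OF that] by (rule measurable_restrict_space1)
      show "\<bar>\<phi> j x\<bar> \<le> 1" if "j \<in> {1..N}" "x \<in> space (restrict_space M S)" for j x
        using that by (auto simp: space_restrict_space S_def)
      fix c :: "nat \<Rightarrow> real"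
      define T where "T = (\<Sum>j=1..N. (c j)\<^sup>2)"
      have T: "0 \<le> T" unfolding T_def by (intro sum_nonneg) auto
      have "R1 * sqrt T \<le> Lp_norm M 2 (lincomb N \<phi> c)"
        using B unfolding bounded_Riesz_basis_def T_def lincomb_def[abs_def] by simp
      then have "(R1 * sqrt T)\<^sup>2 \<le> (Lp_norm M 2 (lincomb N \<phi> c))\<^sup>2"
        using R1 T by (intro power_mono) auto
      also have "\<dots> = Lp_norm M 2 (lincomb N \<phi> c) powr 2" by (simp add: Lp_norm_def)
      also have "\<dots> = (\<integral>x. (lincomb N \<phi> c x)\<^sup>2 \<partial>M)" by (simp add: Lp_norm_powr power_integral_def)
      finally have *: "R1\<^sup>2 * T \<le> (\<integral>x. (lincomb N \<phi> c x)\<^sup>2 \<partial>M)"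
        using T by (simp add: power_mult_distrib)
      \<comment> \<open>Capping \<open>R1\<close> at 1 only weakens the lower bound and meets the
        condition \<open>r \<le> 1\<close> of the locale.\<close>
      have "(min R1 1)\<^sup>2 * T \<le> R1\<^sup>2 * T" using R1 T by (intro mult_right_mono power_mono) auto
      also note *
      also have "(\<integral>x. (lincomb N \<phi> c x)\<^sup>2 \<partial>M) = (\<integral>x. (lincomb N \<phi> c x)\<^sup>2 \<partial>restrict_space M S)"
        by (rule restr[symmetric]) measurable
      finally show "(min R1 1)\<^sup>2 * (\<Sum>j=1..N. (c j)\<^sup>2) \<le> (\<integral>x. (lincomb N \<phi> c x)\<^sup>2 \<partial>restrict_space M S)"
        by (simp add: T_def)
    qed (use N R1 in auto)
  qed
  moreover have "power_integral (restrict_space M S) p (lincomb N \<phi> c) = power_integral M p (lincomb N \<phi> c)" for p c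
    unfolding power_integral_def by (rule restr) measurable
  ultimately show ?thesis using S that by blast
qed

lemma sampling_bound_explicit:
  assumes M: "prob_space M" and p: "1 \<le> p" "p \<le> 2" and R1: "0 < R1"
  shows "sampling_bound M p R1 R2 (2 * sample_const (min R1 1))"
  unfolding sampling_bound_def
proof (intro allI impI)
  fix N :: nat and \<phi> v and \<epsilon> :: real
  assume N2: "2 \<le> N" and B: "bounded_Riesz_basis M N \<phi> R1 R2" and v: "1 \<le> v" "v \<le> N" and \<epsilon>: "0 < \<epsilon>" "\<epsilon> < 1"
  have N1: "1 \<le> N" using N2 by simp
  obtain S where S: "S \<in> sets M" and sys: "bounded_system (restrict_space M S) \<phi> N (min R1 1)"
    and int: "\<And>p c. power_integral (restrict_space M S) p (lincomb N \<phi> c) = power_integral M p (lincomb N \<phi> c)"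
    using bounded_system_restrict[OF M B R1 N1] by blast
  interpret bounded_system "restrict_space M S" \<phi> N "min R1 1" by (rule sys)
  obtain m \<xi> where m: "1 \<le> m"
    "real m \<le> 2 * (sample_const (min R1 1) * (real v * (ln (real N))\<^sup>2 * (ln (2 * real v / \<epsilon>))\<^sup>2) / \<epsilon> ^ 5)"
    and \<xi>: "\<And>j. j < m \<Longrightarrow> \<xi> j \<in> space (restrict_space M S)"
    and approx: "\<And>c. card (coeffs_on N c) \<le> v \<Longrightarrow>
      \<bar>power_mean m \<xi> p (lincomb N \<phi> c) - power_integral (restrict_space M S) p (lincomb N \<phi> c)\<bar>
        \<le> \<epsilon> * power_integral (restrict_space M S) p (lincomb N \<phi> c)"
    using sparse_discretization[OF p \<epsilon>(1) less_imp_le[OF \<epsilon>(2)] N2 v] by blast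
  show "\<exists>(m::nat) \<xi>. 1 \<le> m \<and> (\<forall>j\<in>{1..m}. \<xi> j \<in> space M) \<and>
      real m \<le> 2 * sample_const (min R1 1) * \<epsilon> powr (- p - 5) * real v * (ln (real N))\<^sup>2 * (ln (2 * real v / \<epsilon>))\<^sup>2 \<and>
      (\<forall>f\<in>sparse_sums v N \<phi>.
          (1 - \<epsilon>) * Lp_norm M p f powr p \<le> (\<Sum>j=1..m. \<bar>f (\<xi> j)\<bar> powr p) / real m \<and>
          (\<Sum>j=1..m. \<bar>f (\<xi> j)\<bar> powr p) / real m \<le> (1 + \<epsilon>) * Lp_norm M p f powr p)"
  \<comment> \<open>Samples are numbered from 0 in the product space and from 1 in the
    statement.\<close>
  proof (intro exI[of _ m] exI[of _ "\<lambda>j. \<xi> (j - 1)"] conjI ballI)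
    show "1 \<le> m" by fact
    show "\<xi> (j - 1) \<in> space M" if "j \<in> {1..m}" for j
    proof -
      have "j - 1 < m" using that by auto
      then show ?thesis using \<xi>[of "j - 1"] by (simp add: space_restrict_space)
    qed
    \<comment> \<open>As \<open>\<epsilon> < 1\<close>, the fifth power obtained here is dominated
      by the power in the statement.\<close>
    have "1 / \<epsilon> ^ 5 = \<epsilon> powr (- 5)"
      using \<epsilon> by (simp add: powr_minus inverse_eq_divide powr_numeral)
    also have "\<dots> \<le> \<epsilon> powr (- p - 5)" using p \<epsilon> by (intro powr_mono') auto
    finally have "2 * sample_const (min R1 1) * (real v * (ln (real N))\<^sup>2 * (ln (2 * real v / \<epsilon>))\<^sup>2) * (1 / \<epsilon> ^ 5)
        \<le> 2 * sample_const (min R1 1) * (real v * (ln (real N))\<^sup>2 * (ln (2 * real v / \<epsilon>))\<^sup>2) * \<epsilon> powr (- p - 5)"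
      using sample_const_ge[of "min R1 1" \<epsilon>] R1 \<epsilon> by (intro mult_left_mono mult_nonneg_nonneg) auto
    then show "real m \<le> 2 * sample_const (min R1 1) * \<epsilon> powr (- p - 5) * real v * (ln (real N))\<^sup>2 * (ln (2 * real v / \<epsilon>))\<^sup>2"
      using m(2) by (simp add: mult_ac)
    fix f assume "f \<in> sparse_sums v N \<phi>"
    then obtain c where f: "f = lincomb N \<phi> c" and c: "card (coeffs_on N c) \<le> v"
      by (rule sparse_sums_lincomb)
    define D where "D = (\<Sum>j=1..m. \<bar>f (\<xi> (j - 1))\<bar> powr p) / real m"
    have D: "D = power_mean m \<xi> p f"
      unfolding D_def power_mean_def by (simp add: sum.atLeast1_atMost_eq)
    have "\<bar>D - power_integral M p f\<bar> \<le> \<epsilon> * power_integral M p f"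
      using approx[OF c] unfolding D f int .
    then have "(1 - \<epsilon>) * Lp_norm M p f powr p \<le> D \<and> D \<le> (1 + \<epsilon>) * Lp_norm M p f powr p"
      using p by (simp add: Lp_norm_powr abs_le_iff algebra_simps)
    then show "(1 - \<epsilon>) * Lp_norm M p f powr p \<le> (\<Sum>j=1..m. \<bar>f (\<xi> (j - 1))\<bar> powr p) / real m"
      and "(\<Sum>j=1..m. \<bar>f (\<xi> (j - 1))\<bar> powr p) / real m \<le> (1 + \<epsilon>) * Lp_norm M p f powr p"
      unfolding D_def by auto
  qed
qed

text \<open>The image space carries the final sigma-algebra of \<open>x \<mapsto> (\<phi> 1 x, ..., \<phi> N x)\<close>, so that every
  point of the image has a preimage and the coordinates are measurable.\<close>
lemma sampling_bound_transfer:
  fixes M :: "'a measure"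
  assumes M: "prob_space M"
    and C: "\<And>M' :: (nat \<Rightarrow> real) measure. prob_space M' \<Longrightarrow> sampling_bound M' p R1 R2 C"
  shows "sampling_bound M p R1 R2 C"
  unfolding sampling_bound_def
proof (intro allI impI)
  fix N :: nat and \<phi> :: "nat \<Rightarrow> 'a \<Rightarrow> real" and v and \<epsilon> :: real
  assume N: "2 \<le> N" and B: "bounded_Riesz_basis M N \<phi> R1 R2" and v: "1 \<le> v" "v \<le> N" and \<epsilon>: "0 < \<epsilon>" "\<epsilon> < 1"
  interpret prob_space M by fact
  have meas: "\<phi> j \<in> borel_measurable M" if "j \<in> {1..N}" for j
    using B that by (auto simp: bounded_Riesz_basis_def)
  define T where "T x = (\<lambda>j. \<phi> j x)" for x
  define \<A> where "\<A> = {A. A \<subseteq> T ` space M \<and> T -` A \<inter> space M \<in> sets M}"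
  define K where "K = sigma (T ` space M) \<A>"
  define M' where "M' = distr M K T"
  define \<pi> :: "nat \<Rightarrow> (nat \<Rightarrow> real) \<Rightarrow> real" where "\<pi> j y = y j" for j y
  have A: "\<A> \<subseteq> Pow (T ` space M)" by (auto simp: \<A>_def)
  have T [measurable]: "T \<in> measurable M K"
    unfolding K_def using A by (intro measurable_measure_of) (auto simp: \<A>_def)
  have spK: "space K = T ` space M" unfolding K_def using A by (simp add: space_measure_of)
  have \<pi>: "\<pi> j \<in> borel_measurable K" if "j \<in> {1..N}" for j
  proof (rule measurableI)
    fix B :: "real set" assume B: "B \<in> sets borel"
    have "T -` (\<pi> j -` B \<inter> space K) \<inter> space M = \<phi> j -` B \<inter> space M"
      by (auto simp: \<pi>_def T_def spK)
    then have "\<pi> j -` B \<inter> space K \<in> \<A>"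
      using measurable_sets[OF meas[OF that] B] by (auto simp: \<A>_def spK)
    then show "\<pi> j -` B \<inter> space K \<in> sets K"
      unfolding K_def using A by (simp add: sets_measure_of sigma_sets.Basic)
  qed simp
  have M': "prob_space M'" unfolding M'_def by (rule prob_space_distr) measurable
  have norm: "Lp_norm M' q (\<lambda>y. \<Sum>i\<in>G. c i * \<pi> i y) = Lp_norm M q (\<lambda>x. \<Sum>i\<in>G. c i * \<phi> i x)"
    if "G \<subseteq> {1..N}" for q G and c :: "nat \<Rightarrow> real"
  proof -
    have [measurable]: "\<pi> i \<in> borel_measurable K" if "i \<in> G" for i using \<pi> \<open>G \<subseteq> _\<close> that by auto
    have "(\<integral>y. \<bar>\<Sum>i\<in>G. c i * \<pi> i y\<bar> powr q \<partial>M') = (\<integral>x. \<bar>\<Sum>i\<in>G. c i * \<pi> i (T x)\<bar> powr q \<partial>M)"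
      unfolding M'_def by (rule integral_distr) measurable
    then show ?thesis by (simp add: Lp_norm_def \<pi>_def T_def)
  qed
  have B': "bounded_Riesz_basis M' N \<pi> R1 R2"
    unfolding bounded_Riesz_basis_def
  proof (intro conjI ballI allI)
    fix j assume j: "j \<in> {1..N}"
    note [measurable] = \<pi>[OF j]
    show \<pi>M: "\<pi> j \<in> borel_measurable M'" unfolding M'_def by simp
    have "AE x in M. \<bar>\<pi> j (T x)\<bar> \<le> 1"
      using bounded_Riesz_basis_bound[OF M B] by eventually_elim (use j in \<open>auto simp: \<pi>_def T_def\<close>)
    then have "AE y in M'. \<bar>\<pi> j y\<bar> \<le> 1" unfolding M'_def by (subst AE_distr_iff) measurable
    then show "Linf_norm M' (\<pi> j) \<le> 1"
      unfolding Linf_norm_def using \<pi>M by (intro esssup_I) (auto simp: one_ereal_def)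
  next
    fix a :: "nat \<Rightarrow> real"
    show "R1 * sqrt (\<Sum>j=1..N. \<bar>a j\<bar>\<^sup>2) \<le> Lp_norm M' 2 (\<lambda>x. \<Sum>j=1..N. a j * \<pi> j x)"
      "Lp_norm M' 2 (\<lambda>x. \<Sum>j=1..N. a j * \<pi> j x) \<le> R2 * sqrt (\<Sum>j=1..N. \<bar>a j\<bar>\<^sup>2)"
      using B unfolding norm[OF subset_refl] bounded_Riesz_basis_def by auto
  qed
  obtain m \<xi> where m: "1 \<le> m"
    "real m \<le> C * \<epsilon> powr (- p - 5) * real v * (ln (real N))\<^sup>2 * (ln (2 * real v / \<epsilon>))\<^sup>2"
    and \<xi>: "\<forall>j\<in>{1..m}. \<xi> j \<in> space M'"
    and approx: "\<forall>f\<in>sparse_sums v N \<pi>.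
      (1 - \<epsilon>) * Lp_norm M' p f powr p \<le> (\<Sum>j=1..m. \<bar>f (\<xi> j)\<bar> powr p) / real m \<and>
      (\<Sum>j=1..m. \<bar>f (\<xi> j)\<bar> powr p) / real m \<le> (1 + \<epsilon>) * Lp_norm M' p f powr p"
    using C[OF M'] N B' v \<epsilon> unfolding sampling_bound_def by blast
  have "\<forall>j\<in>{1..m}. \<exists>x\<in>space M. \<xi> j = T x" using \<xi> by (auto simp: M'_def spK)
  then obtain \<zeta> where \<zeta>: "\<And>j. j \<in> {1..m} \<Longrightarrow> \<zeta> j \<in> space M \<and> \<xi> j = T (\<zeta> j)" by metis
  show "\<exists>(m::nat) \<xi>. 1 \<le> m \<and> (\<forall>j\<in>{1..m}. \<xi> j \<in> space M) \<and>
      real m \<le> C * \<epsilon> powr (- p - 5) * real v * (ln (real N))\<^sup>2 * (ln (2 * real v / \<epsilon>))\<^sup>2 \<and>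
      (\<forall>f\<in>sparse_sums v N \<phi>.
          (1 - \<epsilon>) * Lp_norm M p f powr p \<le> (\<Sum>j=1..m. \<bar>f (\<xi> j)\<bar> powr p) / real m \<and>
          (\<Sum>j=1..m. \<bar>f (\<xi> j)\<bar> powr p) / real m \<le> (1 + \<epsilon>) * Lp_norm M p f powr p)"
  proof (intro exI[of _ m] exI[of _ \<zeta>] conjI)
    show "\<forall>f\<in>sparse_sums v N \<phi>.
          (1 - \<epsilon>) * Lp_norm M p f powr p \<le> (\<Sum>j=1..m. \<bar>f (\<zeta> j)\<bar> powr p) / real m \<and>
          (\<Sum>j=1..m. \<bar>f (\<zeta> j)\<bar> powr p) / real m \<le> (1 + \<epsilon>) * Lp_norm M p f powr p"
    proof
      fix f assume "f \<in> sparse_sums v N \<phi>"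
      then obtain G c where G: "G \<subseteq> {1..N}" "card G = v" and f: "f = (\<lambda>x. \<Sum>i\<in>G. c i * \<phi> i x)"
        by (auto simp: sparse_sums_def)
      define g where "g = (\<lambda>y. \<Sum>i\<in>G. c i * \<pi> i y)"
      have "g \<in> sparse_sums v N \<pi>" using G unfolding sparse_sums_def g_def by blast
      moreover have "Lp_norm M' p g = Lp_norm M p f" unfolding f g_def by (rule norm[OF G(1)])
      moreover have "(\<Sum>j=1..m. \<bar>g (\<xi> j)\<bar> powr p) = (\<Sum>j=1..m. \<bar>f (\<zeta> j)\<bar> powr p)"
        using \<zeta> by (intro sum.cong) (auto simp: f g_def \<pi>_def T_def)
      ultimately show "(1 - \<epsilon>) * Lp_norm M p f powr p \<le> (\<Sum>j=1..m. \<bar>f (\<zeta> j)\<bar> powr p) / real m \<and>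
          (\<Sum>j=1..m. \<bar>f (\<zeta> j)\<bar> powr p) / real m \<le> (1 + \<epsilon>) * Lp_norm M p f powr p"
        using approx by metis
    qed
  qed (use m \<zeta> in auto)
qed

theorem corollary5p2:
  fixes p R1 R2 :: real
  assumes "1 \<le> p" and "p \<le> 2" and "0 < R1" and "R1 \<le> R2"
  shows "0 < sampling_const p R1 R2 \<and>
         (\<forall>M :: 'a measure. prob_space M \<longrightarrow> sampling_bound M p R1 R2 (sampling_const p R1 R2))"
proof -
  let ?P = "\<lambda>C. 0 < C \<and> (\<forall>M :: (nat \<Rightarrow> real) measure. prob_space M \<longrightarrow> sampling_bound M p R1 R2 C)"
  have "0 < 2 * sample_const (min R1 1)"
    using sample_const_ge[of "min R1 1" 1] assms(3) by simp
  \<comment> \<open>The explicit constant shows that the choice in \<open>sampling_const\<close> is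
    satisfiable. The chosen value may be a different one, known only for spaces over
    \<open>nat \<Rightarrow> real\<close>, and reaches other types of points by transfer.\<close>
  then have "?P (2 * sample_const (min R1 1))"
    using sampling_bound_explicit assms by blast
  then have "?P (sampling_const p R1 R2)"
    unfolding sampling_const_def by (rule someI[of ?P])
  then show ?thesis using sampling_bound_transfer by blast
qed

end
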